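(* Let $M_{1/2} := \mathbb{N}_0[\frac12]$ be the additive monoid of nonnegative dyadic rationals. If an irreducible polynomial $P(x) \in \mathbb{Z}[x]$ is not atomic as an element of the monoid algebra $\mathbb{Q}[M_{1/2}]$, then $P(x) \in \{\pm x\} \cup \{\pm \Phi_n(x) : n \text{ a positive odd integer}\}$.
   Context: $\mathbb{Q}[M_{1/2}]$ is the integral domain of polynomial expressions $\sum c_i x^{m_i}$ with $c_i \in \mathbb{Q}$ and $m_i \in M_{1/2}$, containing $\mathbb{Z}[x]$. An element of an integral domain is atomic if it is a unit or a finite product of irreducible elements. $\Phi_n(x)$ denotes the $n$-th cyclotomic polynomial. *)

theory Defs
  imports "HOL-Computational_Algebra.Computational_Algebra" "HOL-Library.Poly_Mapping"
begin

typedef dyadic = "{q::rat. 0 \<le> q \<and> (\<exists>k::nat. q * 2 ^ k \<in> \<int>)}"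
  by (rule exI[of _ 0]) auto

setup_lifting type_definition_dyadic

instantiation dyadic :: zero
begin
lift_definition zero_dyadic :: dyadic is "0" by auto
instance ..
end

instantiation dyadic :: plus
begin
lift_definition plus_dyadic :: "dyadic \<Rightarrow> dyadic \<Rightarrow> dyadic" is "(+)"
proof -
  fix a b :: rat
  assume a: "0 \<le> a \<and> (\<exists>k::nat. a * 2 ^ k \<in> \<int>)" and b: "0 \<le> b \<and> (\<exists>k::nat. b * 2 ^ k \<in> \<int>)"
  then obtain k l :: nat where k: "a * 2 ^ k \<in> \<int>" and l: "b * 2 ^ l \<in> \<int>" by blast
  have "(a + b) * 2 ^ (k + l) = (a * 2 ^ k) * 2 ^ l + (b * 2 ^ l) * 2 ^ k"
    by (simp add: power_add algebra_simps)
  also have "\<dots> \<in> \<int>"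
  proof -
    have "(2::rat) ^ l \<in> \<int>" "(2::rat) ^ k \<in> \<int>" by simp_all
    then show ?thesis using k l by (simp add: Ints_add Ints_mult)
  qed
  finally show "0 \<le> a + b \<and> (\<exists>k::nat. (a + b) * 2 ^ k \<in> \<int>)" using a b by auto
qed
instance ..
end

instantiation dyadic :: linorder
begin
lift_definition less_eq_dyadic :: "dyadic \<Rightarrow> dyadic \<Rightarrow> bool" is "(\<le>)" .
lift_definition less_dyadic :: "dyadic \<Rightarrow> dyadic \<Rightarrow> bool" is "(<)" .
instance
proof
  fix x y z :: dyadic
  show "(x < y) = (x \<le> y \<and> \<not> y \<le> x)" by transfer linarith
  show "x \<le> x" by transfer linarith
  show "x \<le> y \<Longrightarrow> y \<le> z \<Longrightarrow> x \<le> z" by transfer linarith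
  show "x \<le> y \<Longrightarrow> y \<le> x \<Longrightarrow> x = y" by transfer linarith
  show "x \<le> y \<or> y \<le> x" by transfer linarith
qed
end

text \<open>Truncated subtraction (needed only to instantiate the cancellative monoid class).\<close>
instantiation dyadic :: minus
begin
lift_definition minus_dyadic :: "dyadic \<Rightarrow> dyadic \<Rightarrow> dyadic" is "\<lambda>a b. if b \<le> a then a - b else 0"
proof -
  fix a b :: rat
  assume a: "0 \<le> a \<and> (\<exists>k::nat. a * 2 ^ k \<in> \<int>)" and b: "0 \<le> b \<and> (\<exists>k::nat. b * 2 ^ k \<in> \<int>)"
  then obtain k l :: nat where k: "a * 2 ^ k \<in> \<int>" and l: "b * 2 ^ l \<in> \<int>" by blast
  have "(a - b) * 2 ^ (k + l) = (a * 2 ^ k) * 2 ^ l - (b * 2 ^ l) * 2 ^ k"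
    by (simp add: power_add algebra_simps)
  also have "\<dots> \<in> \<int>"
  proof -
    have "(2::rat) ^ l \<in> \<int>" "(2::rat) ^ k \<in> \<int>" by simp_all
    then show ?thesis using k l by (simp add: Ints_diff Ints_mult)
  qed
  finally show "0 \<le> (if b \<le> a then a - b else 0) \<and>
      (\<exists>k::nat. (if b \<le> a then a - b else 0) * 2 ^ k \<in> \<int>)"
    by (auto intro: exI[of _ 0])
qed
instance ..
end

instance dyadic :: ordered_cancel_comm_monoid_add
proof
  fix a b c :: dyadic
  show "a + b + c = a + (b + c)" by transfer simp
  show "a + b = b + a" by transfer simp
  show "0 + a = a" by transfer simp
  show "a + b - a = b" by transfer simp
  show "a - b - c = a - (b + c)" by transfer auto
  show "a \<le> b \<Longrightarrow> c + a \<le> c + b" by transfer simp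
qed

lift_definition dyadic_of_nat :: "nat \<Rightarrow> dyadic" is "of_nat"
  by (auto intro: exI[of _ 0])

type_synonym QM = "dyadic \<Rightarrow>\<^sub>0 rat"

definition poly_to_QM :: "int poly \<Rightarrow> QM" where
  "poly_to_QM p = (\<Sum>i\<le>degree p. Poly_Mapping.single (dyadic_of_nat i) (rat_of_int (coeff p i)))"

definition atomic :: "'a::comm_semiring_1 \<Rightarrow> bool" where
  "atomic a \<longleftrightarrow> a dvd 1 \<or> (\<exists>xs. xs \<noteq> [] \<and> (\<forall>x\<in>set xs. irreducible x) \<and> a = prod_list xs)"

definition cyclotomic :: "nat \<Rightarrow> complex poly" where
  "cyclotomic n = (\<Prod>z\<in>{z::complex. z ^ n = 1 \<and> (\<forall>m\<in>{1..<n}. z ^ m \<noteq> 1)}. [:-z, 1:])"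

end

theory Submission
  imports Defs "HOL-Computational_Algebra.Field_as_Ring"
begin

text \<open>
  Write \<open>x\<^sub>k = x\<^bsup>1/2^k\<^esup>\<close>, so that the monoid algebra is the increasing union of the rings
  \<open>\<rat>[x\<^sub>k]\<close> and \<open>P\<close> becomes \<open>P(x\<^sub>k\<^bsup>2^k\<^esup>)\<close> in the \<open>k\<close>-th one. If \<open>P\<close> is not atomic, then following
  a non-atomic factor from level to level gives a never-ending chain of irreducible polynomials
  \<open>f\<^sub>0 = P, f\<^sub>1, f\<^sub>2, \<dots>\<close> over \<open>\<rat>\<close>, where \<open>f\<^sub>n\<^sub>+\<^sub>1\<close> divides \<open>f\<^sub>n(x\<^bsup>2^j\<^esup>)\<close> for some \<open>j > 0\<close>. By the
  \<open>x\<^sup>4 - \<alpha>\<close> case of Capelli's theorem the degree can double only once along the chain. The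
  primitive integer multiples of the \<open>f\<^sub>n\<close> therefore have bounded degree, bounded roots and leading
  coefficients dividing that of \<open>P\<close>, so there are only finitely many of them and the chain is
  repeats a member up to a unit. Hence some power map \<open>z \<mapsto> z\<^bsup>2^j\<^esup>\<close> with \<open>j > 0\<close> sends the roots of
  some \<open>f\<^sub>n\<close> to roots of \<open>f\<^sub>n\<close>; its periodic points are roots of unity of odd order, and their
  \<open>2\<close>-power powers include a root of \<open>P\<close>. Irreducibility of the cyclotomic
  polynomials finishes the proof.
\<close>

section \<open>Substituting squares\<close>

text \<open>Rewrites a polynomial in x^(1/2^k) as one in x^(1/2^(k+1)).\<close>

definition sq_subst :: "'a::comm_ring_1 poly \<Rightarrow> 'a poly" where
  "sq_subst p = pcompose p (monom 1 2)"

text \<open>The conjugation of Q[x] over Q[x^2]; it yields norms such as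
  \<open>a ^ 2 - pX * b ^ 2\<close>.\<close>

definition reflect_arg :: "'a::comm_ring_1 poly \<Rightarrow> 'a poly" where
  "reflect_arg p = pcompose p [:0, - 1:]"

abbreviation pX :: "'a::comm_ring_1 poly" where
  "pX \<equiv> [:0, 1:]"

lemma sq_subst_simps [simp]:
  "sq_subst 0 = 0" "sq_subst 1 = 1" "sq_subst [:c:] = [:c:]" "sq_subst pX = pX ^ 2"
  "sq_subst (p + q) = sq_subst p + sq_subst q"
  "sq_subst (p - q) = sq_subst p - sq_subst q" "sq_subst (- p) = - sq_subst p"
  "sq_subst (p * q) = sq_subst p * sq_subst q"
  "sq_subst (smult c p) = smult c (sq_subst p)"
  by (simp_all add: sq_subst_def pcompose_add pcompose_diff pcompose_uminus pcompose_mult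
      pcompose_smult      pcompose_1 pcompose_pCons monom_altdef)

lemma sq_subst_power [simp]: "sq_subst (p ^ n) = sq_subst p ^ n"
  by (induction n) simp_all

lemma sq_subst_pCons: "sq_subst (pCons c p) = [:c:] + pX ^ 2 * sq_subst p"
  by (simp add: sq_subst_def pcompose_pCons monom_altdef)

lemma poly_sq_subst [simp]: "poly (sq_subst p) x = poly p (x ^ 2)"
  by (simp add: sq_subst_def poly_pcompose poly_monom)

lemma degree_sq_subst [simp]: "degree (sq_subst p) = 2 * degree (p :: 'a::idom poly)"
  by (simp add: sq_subst_def degree_pcompose degree_monom_eq)

lemma sq_subst_eq_0_iff [simp]: "sq_subst p = 0 \<longleftrightarrow> (p :: 'a::idom poly) = 0"
  by (simp add: sq_subst_def pcompose_eq_0_iff degree_monom_eq)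

lemma coeff_0_sq_subst [simp]: "coeff (sq_subst p) 0 = coeff p 0"
  by (metis poly_0_coeff_0 poly_sq_subst zero_power2)

lemma sq_subst_dvd: "p dvd q \<Longrightarrow> sq_subst p dvd sq_subst q"
  by (auto elim!: dvdE)

lemma reflect_arg_simps [simp]:
  "reflect_arg 0 = 0" "reflect_arg 1 = 1" "reflect_arg [:c:] = [:c:]" "reflect_arg pX = - pX"
  "reflect_arg (p + q) = reflect_arg p + reflect_arg q"
  "reflect_arg (p - q) = reflect_arg p - reflect_arg q"
  "reflect_arg (p * q) = reflect_arg p * reflect_arg q"
  by (simp_all add: reflect_arg_def pcompose_add pcompose_diff pcompose_mult pcompose_1 pcompose_pCons)

lemma reflect_arg_power [simp]: "reflect_arg (p ^ n) = reflect_arg p ^ n"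
  by (induction n) simp_all

lemma reflect_arg_sq_subst [simp]: "reflect_arg (sq_subst p) = sq_subst p"
proof -
  have "pcompose (monom 1 2) [:0, - 1:] = (monom 1 2 :: 'a poly)"
    by (simp add: monom_altdef pcompose_mult pcompose_pCons power2_eq_square)
  then show ?thesis
    by (simp add: reflect_arg_def sq_subst_def pcompose_assoc[symmetric])
qed

lemma reflect_arg_dvd: "p dvd q \<Longrightarrow> reflect_arg p dvd reflect_arg q"
  by (auto elim!: dvdE)

lemma degree_reflect_arg [simp]: "degree (reflect_arg p) = degree (p :: 'a::idom poly)"
  by (simp add: reflect_arg_def degree_pcompose)

lemma even_odd_parts:
  obtains a b where "p = sq_subst a + pX * sq_subst b"
proof -
  have "\<exists>a b. p = sq_subst a + pX * sq_subst b"
  proof (induction p)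
    case 0
    show ?case by (rule exI[of _ 0], rule exI[of _ 0]) simp
  next
    case (pCons c p)
    then obtain a b where ab: "p = sq_subst a + pX * sq_subst b" by blast
    have "pCons c p = [:c:] + pX * p" by simp
    also have "\<dots> = sq_subst ([:c:] + pX * b) + pX * sq_subst a"
      unfolding ab sq_subst_simps power2_eq_square by (simp only: ring_distribs mult.assoc ac_simps)
    finally show ?case by blast
  qed
  then show thesis using that by blast
qed

lemma even_odd_parts_zero:
  fixes a b :: "rat poly"
  assumes "sq_subst a + pX * sq_subst b = 0"
  shows "a = 0" "b = 0"
proof -
  have "reflect_arg (sq_subst a + pX * sq_subst b) = 0"
    using assms by simp
  then have "sq_subst a - pX * sq_subst b = 0"
    by (simp only: reflect_arg_simps reflect_arg_sq_subst)
  with assms have "2 * sq_subst a = 0" "2 * (pX * sq_subst b) = 0"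
    by algebra+
  then show "a = 0" "b = 0" by simp_all
qed

text \<open>Since 1 and x form a basis of Q[x] over Q[x^2], the quotient splits into parts as well
  and can be compared coordinatewise.\<close>

lemma sq_subst_dvd_iff:
  fixes f a b :: "rat poly"
  shows "sq_subst f dvd sq_subst a + pX * sq_subst b \<longleftrightarrow> f dvd a \<and> f dvd b"
proof
  assume "sq_subst f dvd sq_subst a + pX * sq_subst b"
  then obtain q where q: "sq_subst a + pX * sq_subst b = sq_subst f * q" by (elim dvdE)
  obtain u v where uv: "q = sq_subst u + pX * sq_subst v" by (rule even_odd_parts)
  have "sq_subst (a - f * u) + pX * sq_subst (b - f * v) = 0"
    using q uv unfolding sq_subst_simps by algebra
  from even_odd_parts_zero[OF this] show "f dvd a \<and> f dvd b" by simp
next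
  assume "f dvd a \<and> f dvd b"
  then show "sq_subst f dvd sq_subst a + pX * sq_subst b"
    by (intro dvd_add dvd_mult sq_subst_dvd) simp_all
qed

corollary sq_subst_eq_iff:
  fixes a b :: "rat poly"
  shows "sq_subst a = sq_subst b \<longleftrightarrow> a = b"
  using even_odd_parts_zero(1)[of "a - b" 0] by auto

section \<open>Factors of f(x^2) for irreducible f\<close>

lemma irreducible_degree_pos: 
  assumes "irreducible (f :: 'a::field poly)"
  shows "degree f > 0"
  using assms is_unit_iff_degree[of f] by (auto simp: irreducible_def)

lemma irreducible_imp_prime_rat:
  assumes "irreducible (f :: rat poly)"
  shows "prime_elem f"
  using assms by (rule irreducible_imp_prime_elem_gcd)

lemma irreducible_inverse_mod:
  assumes "irreducible (f :: rat poly)" "\<not> f dvd b"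
  obtains v where "f dvd b * v - 1"
proof -
  have "coprime f b"
    using assms irreducible_imp_prime_rat prime_elem_imp_coprime by blast
  then obtain x y where "x * f + y * b = 1"
    using bezout_coefficients_fst_snd[of f b] by (metis coprime_iff_gcd_eq_1)
  then have "b * y - 1 = f * (- x)" by algebra
  then show thesis using that by (metis dvd_triv_left)
qed

text \<open>For irreducible \<open>f\<close>, the condition \<open>f dvd h ^ 2 - pX\<close> expresses that a root of \<open>f\<close> is a
  square in the field that it generates.\<close>

lemma sq_subst_reducible_if_square:
  fixes f h :: "rat poly"
  assumes "irreducible f" "f dvd h ^ 2 - pX"
  shows "\<not> irreducible (sq_subst f)"
proof
  assume "irreducible (sq_subst f)"
  then have p: "prime_elem (sq_subst f)" by (rule irreducible_imp_prime_rat)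
  have "sq_subst f dvd sq_subst (h ^ 2 - pX)" using assms(2) by (rule sq_subst_dvd)
  \<comment> \<open>A difference of squares: a prime f(x^2) would divide h(x^2) + x or h(x^2) - x,
    hence f would divide the odd part 1 or -1.\<close>
  also have "sq_subst (h ^ 2 - pX) = (sq_subst h + pX * sq_subst 1) * (sq_subst h + pX * sq_subst (- 1))"
    unfolding sq_subst_simps sq_subst_power by algebra
  finally have "f dvd 1"
    using p sq_subst_dvd_iff[of f h 1] sq_subst_dvd_iff[of f h "-1"]
    by (auto simp: prime_elem_dvd_mult_iff)
  with assms(1) show False using irreducible_not_unit by blast
qed

text \<open>The norms of \<open>g\<close> and \<open>t\<close> multiply to \<open>f ^ 2\<close> and
  neither is a unit, so each is \<open>f\<close> up to a unit. This fixes the degree of every proper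
  factor, which forces irreducibility. Dividing a^2 = x b^2 by b^2 modulo \<open>f\<close> exhibits
  x as a square.\<close>

lemma sq_subst_factors:
  fixes f :: "rat poly"
  assumes f: "irreducible f" and gt: "sq_subst f = g * t" "\<not> is_unit g" "\<not> is_unit t"
  shows "degree g = degree f" "irreducible g" "\<exists>h. f dvd h ^ 2 - pX"
proof -
  text \<open>The norm of \<open>g\<close> with respect to \<open>x \<mapsto> -x\<close> is associated to \<open>f\<close>.\<close>
  have norm_assoc: "\<exists>a b u. g = sq_subst a + pX * sq_subst b \<and> is_unit u \<and>
      a ^ 2 - pX * b ^ 2 = f * u \<and> degree g = degree f"
    if gt: "sq_subst f = g * t" "\<not> is_unit g" "\<not> is_unit t" for g t
  proof -
    have f0: "f \<noteq> 0" using f by auto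
    then have g0: "g \<noteq> 0" "t \<noteq> 0" using gt(1) by auto
    obtain a b where ab: "g = sq_subst a + pX * sq_subst b" by (rule even_odd_parts)
    obtain c d where cd: "t = sq_subst c + pX * sq_subst d" by (rule even_odd_parts)
    define m n where "m = a ^ 2 - pX * b ^ 2" and "n = c ^ 2 - pX * d ^ 2"
    have rg: "reflect_arg g = sq_subst a - pX * sq_subst b"
      and rt: "reflect_arg t = sq_subst c - pX * sq_subst d"
      unfolding ab cd reflect_arg_simps reflect_arg_sq_subst by algebra+
    have m: "sq_subst m = g * reflect_arg g" and n: "sq_subst n = t * reflect_arg t"
      unfolding m_def n_def rg rt unfolding ab cd sq_subst_simps sq_subst_power by algebra+
    have dm: "degree m = degree g" and dn: "degree n = degree t"
      using m n g0 degree_sq_subst[of m] degree_sq_subst[of n]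
        degree_reflect_arg[of g] degree_reflect_arg[of t]
      by (simp_all add: degree_mult_eq) (metis degree_0 degree_mult_eq degree_reflect_arg
        mult_2 mult_zero_right nat_mult_eq_cancel1 zero_less_numeral)+
    have "sq_subst f * reflect_arg (sq_subst f) = sq_subst m * sq_subst n"
      unfolding m n gt(1) reflect_arg_simps by algebra
    then have "sq_subst (f ^ 2) = sq_subst (m * n)"
      by (simp add: power2_eq_square)
    then have fmn: "f ^ 2 = m * n"
      by (simp only: sq_subst_eq_iff)
    have mn_nonunit: "\<not> is_unit m" "\<not> is_unit n"
      using gt(2,3) g0 dm dn f0 fmn
      by (metis is_unit_iff_degree mult_zero_left mult_zero_right power_not_zero)+
    have fm: "f dvd m"
    proof (rule ccontr)
      assume "\<not> f dvd m"
      then have "f dvd n" using fmn irreducible_imp_prime_rat[OF f]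
        by (metis dvd_triv_left power2_eq_square prime_elem_dvd_mult_iff)
      then obtain k where "n = f * k" by (elim dvdE)
      with fmn f0 have "f = m * k" by (simp add: power2_eq_square mult.assoc)
      with f mn_nonunit(1) have "is_unit k" by (meson irreducibleD)
      with \<open>f = m * k\<close> \<open>\<not> f dvd m\<close> show False
        by (metis dvd_mult_unit_iff' dvd_refl mult.commute mult_unit_dvd_iff)
    qed
    then obtain u where u: "m = f * u" by (elim dvdE)
    with fmn f0 have "f = u * n" by (simp add: power2_eq_square mult.assoc)
    with f mn_nonunit(2) have uu: "is_unit u" by (meson irreducibleD)
    moreover have "degree m = degree f"
      using u uu f0 is_unit_iff_degree[of u] by (cases "u = 0") (auto simp: degree_mult_eq)
    ultimately show ?thesis
      using ab u dm unfolding m_def by auto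
  qed
  show dg: "degree g = degree f"
    using norm_assoc[OF gt] by blast
  have f0: "f \<noteq> 0" using f by auto
  then have g0: "g \<noteq> 0" "t \<noteq> 0" using gt(1) by auto
  show "irreducible g"
  proof (rule irreducibleI)
    fix a b assume ab: "g = a * b"
    show "is_unit a \<or> is_unit b"
    proof (rule ccontr)
      assume n: "\<not> (is_unit a \<or> is_unit b)"
      have "sq_subst f = a * (b * t)" using gt(1) ab by (simp add: mult.assoc)
      moreover have "\<not> is_unit (b * t)" using n by (simp add: is_unit_mult_iff)
      ultimately have "degree a = degree f"
        using norm_assoc[of a "b * t"] n by blast
      then have "degree b = 0"
        using dg ab g0 by (auto simp: degree_mult_eq)
      with n g0 ab show False by (auto simp: is_unit_iff_degree)
    qed
  qed (use g0 gt in auto)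
  from norm_assoc[OF gt] obtain a b u where ab: "g = sq_subst a + pX * sq_subst b"
    and u: "a ^ 2 - pX * b ^ 2 = f * u" by blast
  \<comment> \<open>Otherwise f divides a too, so f(x^2) would divide g, whose degree is too
    small.\<close>
  have "\<not> f dvd b"
  proof
    assume b: "f dvd b"
    then have "f dvd (a ^ 2 - pX * b ^ 2) + pX * b ^ 2"
      unfolding u by (intro dvd_add dvd_triv_left dvd_mult) (simp add: power2_eq_square)
    then have "f dvd a"
      using irreducible_imp_prime_rat[OF f] by (auto dest: prime_elem_dvd_power)
    then have "sq_subst f dvd g"
      using b by (simp only: ab sq_subst_dvd_iff)
    then have "degree (sq_subst f) \<le> degree g"
      using g0 by (intro dvd_imp_degree_le)
    then show False using dg irreducible_degree_pos[OF f] by simp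
  qed
  with f obtain v where "f dvd b * v - 1" by (rule irreducible_inverse_mod)
  moreover have "(a * v) ^ 2 - pX = f * (u * v ^ 2) + (b * v - 1) * (pX * (b * v + 1))"
    using u by algebra
  ultimately have "f dvd (a * v) ^ 2 - pX" by (metis dvd_add dvd_triv_left dvd_mult2)
  then show "\<exists>h. f dvd h ^ 2 - pX" by blast
qed

section \<open>Capelli's theorem for fourth roots\<close>

lemma sq_subst_reducibleE:
  fixes f :: "rat poly"
  assumes "irreducible f" "\<not> irreducible (sq_subst f)"
  obtains g t where "sq_subst f = g * t" "irreducible g" "irreducible t"
    "degree g = degree f" "degree t = degree f"
proof -
  have "sq_subst f \<noteq> 0" "\<not> is_unit (sq_subst f)"
    using irreducible_degree_pos[OF assms(1)] is_unit_iff_degree[of "sq_subst f"]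
    by (cases "f = 0"; force)+
  with assms(2) obtain g t where gt: "sq_subst f = g * t" "\<not> is_unit g" "\<not> is_unit t"
    by (auto simp: irreducible_def)
  moreover from gt(1) have "sq_subst f = t * g" by (simp only: mult.commute)
  ultimately show thesis
    using sq_subst_factors(1,2)[OF assms(1)] that by metis
qed

corollary square_if_sq_subst_reducible:
  fixes f :: "rat poly"
  assumes "irreducible f" "\<not> irreducible (sq_subst f)"
  obtains h where "f dvd h ^ 2 - pX"
  using assms by (metis irreducible_not_unit sq_subst_factors(3) sq_subst_reducibleE)

text \<open>This is the instance \<open>n = 4\<close> of Capelli's theorem: if \<open>\<alpha>\<close> is not a square in a field but
  \<open>x\<^sup>4 - \<alpha>\<close> is reducible, then \<open>\<alpha> = - 4 u\<^sup>4\<close>, and \<open>-1\<close> is a square after adjoining \<open>\<surd>\<alpha>\<close>.\<close>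

lemma capelli_4:
  fixes f :: "rat poly"
  assumes f: "coeff f 0 \<noteq> 0" and f2: "irreducible (sq_subst f)"
    and f4: "\<not> irreducible (sq_subst (sq_subst f))"
  obtains w s where "f dvd pX + w ^ 2" "sq_subst f dvd s ^ 2 + 1"
proof -
  obtain h where h: "sq_subst f dvd h ^ 2 - pX"
    using f2 f4 by (rule square_if_sq_subst_reducible)
  obtain u v where uv: "h = sq_subst u + pX * sq_subst v" by (rule even_odd_parts)
  have "h ^ 2 - pX = sq_subst (u ^ 2 + pX * v ^ 2) + pX * sq_subst (2 * u * v - 1)"
    unfolding uv mult_2 sq_subst_simps sq_subst_power by algebra
  with h have d: "f dvd u ^ 2 + pX * v ^ 2" "f dvd 2 * u * v - 1"
    by (simp_all only: sq_subst_dvd_iff)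
  \<comment> \<open>Modulo f, the even and odd parts give u^2 + x v^2 = 0 and 2 u v = 1. Multiplying
    the first by 4 u^2 yields x = -(2 u^2)^2.\<close>
  have "pX + (2 * u ^ 2) ^ 2 =
      4 * u ^ 2 * (u ^ 2 + pX * v ^ 2) - (2 * u * v - 1) * (pX * (2 * u * v + 1))"
    by algebra
  then have w: "f dvd pX + (2 * u ^ 2) ^ 2"
    using d by (metis dvd_diff dvd_mult dvd_mult2)
  have "\<not> sq_subst f dvd pX"
  proof
    assume "sq_subst f dvd pX"
    then have "sq_subst f dvd sq_subst 0 + pX * sq_subst 1" by simp
    then have "f dvd 1" by (simp only: sq_subst_dvd_iff)
    then have "sq_subst f dvd sq_subst 1" by (rule sq_subst_dvd)
    with irreducible_not_unit[OF f2] show False by simp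
  qed
  with f2 obtain y where y: "sq_subst f dvd pX * y - 1" by (rule irreducible_inverse_mod)
  \<comment> \<open>Modulo f(x^2), x^2 = -z^2 and \<open>y\<close> inverts x, so z / x is a square
    root of -1.\<close>
  define z where "z = sq_subst (2 * u ^ 2)"
  have "sq_subst f dvd sq_subst (pX + (2 * u ^ 2) ^ 2)"
    using w by (rule sq_subst_dvd)
  then have "sq_subst f dvd pX ^ 2 + z ^ 2"
    unfolding z_def by (simp only: sq_subst_simps sq_subst_power)
  moreover have "(y * z) ^ 2 + 1 = (pX ^ 2 + z ^ 2) * y ^ 2 - (pX * y - 1) * (pX * y + 1)"
    by algebra
  ultimately have "sq_subst f dvd (y * z) ^ 2 + 1"
    using y by (metis dvd_diff dvd_mult2)
  with w show thesis by (rule that)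
qed

text \<open>Otherwise \<open>capelli_4\<close> gives x = -w^2 modulo f; with s^2 = -1 this is (s
  w)^2, so f(x^2) would already split.\<close>

lemma irreducible_sq_subst2_if_imaginary:
  fixes f :: "rat poly"
  assumes f: "irreducible f" "coeff f 0 \<noteq> 0" "f dvd s ^ 2 + 1" and f2: "irreducible (sq_subst f)"
  shows "irreducible (sq_subst (sq_subst f))"
proof (rule ccontr)
  assume "\<not> irreducible (sq_subst (sq_subst f))"
  with f(2) f2 obtain w s' where "f dvd pX + w ^ 2" by (rule capelli_4)
  moreover have "(s * w) ^ 2 - pX = (s ^ 2 + 1) * w ^ 2 - (pX + w ^ 2)" by algebra
  ultimately have "f dvd (s * w) ^ 2 - pX"
    using f(3) by (metis dvd_diff dvd_mult2)
  with f(1) have "\<not> irreducible (sq_subst f)" by (rule sq_subst_reducible_if_square)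
  with f2 show False by contradiction
qed

text \<open>Otherwise \<open>capelli_4\<close>, applied to f(x^2), makes -x a square modulo f(x^2).
  As f(x^2) is even, replacing x by -x makes x a square too, so f(x^4) would split.\<close>

lemma irreducible_sq_subst3:
  fixes f :: "rat poly"
  assumes f: "coeff f 0 \<noteq> 0" and f2: "irreducible (sq_subst f)"
    and f4: "irreducible (sq_subst (sq_subst f))"
  shows "irreducible (sq_subst (sq_subst (sq_subst f)))"
proof (rule ccontr)
  assume "\<not> irreducible (sq_subst (sq_subst (sq_subst f)))"
  moreover have "coeff (sq_subst f) 0 \<noteq> 0" using f by simp
  ultimately obtain w s where "sq_subst f dvd pX + w ^ 2"
    using f4 capelli_4 by blast
  then have "reflect_arg (sq_subst f) dvd reflect_arg (pX + w ^ 2)" by (rule reflect_arg_dvd)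
  then have "sq_subst f dvd - pX + reflect_arg w ^ 2"
    by (simp only: reflect_arg_sq_subst reflect_arg_simps reflect_arg_power)
  then have "sq_subst f dvd reflect_arg w ^ 2 - pX"
    by (simp only: diff_conv_add_uminus add.commute)
  with f2 have "\<not> irreducible (sq_subst (sq_subst f))" by (rule sq_subst_reducible_if_square)
  with f4 show False by contradiction
qed

text \<open>Hence any splitting shows within two substitutions. The induction carries three
  consecutive levels.\<close>

lemma irreducible_sq_subst_iterate:
  fixes f :: "rat poly"
  assumes "coeff f 0 \<noteq> 0" "irreducible f" "irreducible (sq_subst f)"
    "irreducible (sq_subst (sq_subst f))"
  shows "irreducible ((sq_subst ^^ j) f)"
proof -
  have "coeff ((sq_subst ^^ j) f) 0 \<noteq> 0 \<and> irreducible ((sq_subst ^^ j) f) \<and>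
      irreducible (sq_subst ((sq_subst ^^ j) f)) \<and>
      irreducible (sq_subst (sq_subst ((sq_subst ^^ j) f)))"
    using assms by (induction j) (auto intro: irreducible_sq_subst3)
  then show ?thesis by blast
qed

section \<open>The monoid algebra as a union of polynomial rings\<close>

lift_definition dyadic_frac :: "nat \<Rightarrow> nat \<Rightarrow> dyadic" is "\<lambda>k i. of_nat i / 2 ^ k"
proof -
  fix k i :: nat
  have "(of_nat i / 2 ^ k :: rat) * 2 ^ k \<in> \<int>" by simp
  then show "0 \<le> (of_nat i / 2 ^ k :: rat) \<and> (\<exists>l. of_nat i / 2 ^ k * 2 ^ l \<in> (\<int> :: rat set))"
    by (intro conjI exI[of _ k]) simp_all
qed

lemma dyadic_frac_0 [simp]: "dyadic_frac k 0 = 0"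
  by transfer simp

lemma dyadic_frac_add: "dyadic_frac k (i + j) = dyadic_frac k i + dyadic_frac k j"
  by transfer (simp add: add_divide_distrib)

lemma dyadic_frac_Suc: "dyadic_frac k 1 + dyadic_frac k i = dyadic_frac k (Suc i)"
  by (metis dyadic_frac_add plus_1_eq_Suc)

lemma dyadic_frac_Suc_double: "dyadic_frac (Suc k) (2 * i) = dyadic_frac k i"
  by transfer simp

lemma dyadic_frac_eq_iff [simp]: "dyadic_frac k i = dyadic_frac k j \<longleftrightarrow> i = j"
  by transfer simp

lemma dyadic_frac_zero: "dyadic_frac 0 i = dyadic_of_nat i"
  by transfer simp

lemma dyadic_fracE: obtains k i where "q = dyadic_frac k i"
proof -
  have "\<exists>k i. q = dyadic_frac k i"
  proof transfer
    fix q :: rat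
    assume "0 \<le> q \<and> (\<exists>k::nat. q * 2 ^ k \<in> \<int>)"
    then obtain k :: nat and z where q: "0 \<le> q" and z: "q * 2 ^ k = of_int z"
      by (auto elim: Ints_cases)
    from q have "0 \<le> q * 2 ^ k" by simp
    with z have "q * 2 ^ k = of_nat (nat z)" by simp
    then have "q = of_nat (nat z) / 2 ^ k" by (simp add: field_simps)
    then show "\<exists>k i. q = of_nat i / 2 ^ k" by blast
  qed
  then show thesis using that by blast
qed

text \<open>The embedding \<open>\<rat>[x] \<rightarrow> \<rat>[M\<^sub>1\<^sub>/\<^sub>2]\<close> with \<open>x \<mapsto> x\<^bsup>1/2^k\<^esup>\<close>; the monoid algebra is the
  increasing union of the images.\<close>

definition root_embed :: "nat \<Rightarrow> rat poly \<Rightarrow> QM" where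
  "root_embed k f = (\<Sum>i\<le>degree f. Poly_Mapping.single (dyadic_frac k i) (coeff f i))"

lemma root_embed_altdef:
  assumes "degree f \<le> n"
  shows "root_embed k f = (\<Sum>i\<le>n. Poly_Mapping.single (dyadic_frac k i) (coeff f i))"
  unfolding root_embed_def using assms
  by (intro sum.mono_neutral_left) (auto simp: coeff_eq_0)

lemma lookup_embed: "Poly_Mapping.lookup (root_embed k f) (dyadic_frac k i) = coeff f i"
proof -
  have "Poly_Mapping.lookup (root_embed k f) (dyadic_frac k i) =
      (\<Sum>j\<le>max i (degree f). if j = i then coeff f i else 0)"
    unfolding root_embed_altdef[of f "max i (degree f)", OF max.cobounded2] lookup_sum
    by (intro sum.cong) (auto simp: lookup_single when_def)
  then show ?thesis by simp
qed

lemma root_embed_inject: "root_embed k f = root_embed k g \<Longrightarrow> f = g"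
  by (intro poly_eqI) (metis lookup_embed)

lemma root_embed_0 [simp]: "root_embed k 0 = 0"
  by (simp add: root_embed_def)

lemma root_embed_const: "root_embed k [:c:] = Poly_Mapping.single 0 c"
  by (simp add: root_embed_def)

lemma root_embed_1 [simp]: "root_embed k 1 = 1"
  by (metis root_embed_const one_pCons single_one)

lemma root_embed_add: "root_embed k (f + g) = root_embed k f + root_embed k g"
proof -
  let ?n = "max (degree f) (degree g)"
  have "degree (f + g) \<le> ?n" by (rule degree_add_le_max)
  then show ?thesis
    by (simp add: root_embed_altdef[of _ ?n] single_add sum.distrib)
qed

lemma root_embed_smult: "root_embed k (smult c f) = Poly_Mapping.single 0 c * root_embed k f"
  by (simp add: root_embed_altdef[of _ "degree f"] degree_smult_le sum_distrib_left mult_single)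

lemma root_embed_pCons:
  "root_embed k (pCons c f) = Poly_Mapping.single 0 c + Poly_Mapping.single (dyadic_frac k 1) 1 * root_embed k f"
proof -
  have "root_embed k (pCons c f) =
      (\<Sum>i\<le>Suc (degree f). Poly_Mapping.single (dyadic_frac k i) (coeff (pCons c f) i))"
    by (intro root_embed_altdef degree_pCons_le)
  also have "\<dots> = Poly_Mapping.single 0 c +
      (\<Sum>i\<le>degree f. Poly_Mapping.single (dyadic_frac k (Suc i)) (coeff f i))"
    unfolding sum.atMost_Suc_shift by simp
  also have "(\<Sum>i\<le>degree f. Poly_Mapping.single (dyadic_frac k (Suc i)) (coeff f i)) =
      Poly_Mapping.single (dyadic_frac k 1) 1 * root_embed k f"
    by (simp add: root_embed_def sum_distrib_left mult_single dyadic_frac_Suc del: One_nat_def)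
  finally show ?thesis .
qed

lemma root_embed_monom: "root_embed k (monom c i) = Poly_Mapping.single (dyadic_frac k i) c"
  by (induction i) (simp_all add: monom_0 monom_Suc root_embed_const root_embed_pCons mult_single
      dyadic_frac_Suc del: One_nat_def)

lemma root_embed_mult: "root_embed k (f * g) = root_embed k f * root_embed k g"
proof (induction f)
  case (pCons c f)
  then show ?case
    by (simp add: root_embed_add root_embed_smult root_embed_pCons algebra_simps)
qed simp

text \<open>The relation (x^(1/2^(k+1)))^2 = x^(1/2^k), by which elements move to higher
  levels.\<close>

lemma root_embed_sq_subst: "root_embed (Suc k) (sq_subst f) = root_embed k f"
proof (induction f)
  case (pCons c f)
  have "root_embed (Suc k) (pX ^ 2) = Poly_Mapping.single (dyadic_frac k 1) 1"
    using dyadic_frac_add[of "Suc k" 1 1] dyadic_frac_Suc_double[of k 1, unfolded mult_2]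
    by (simp add: power2_eq_square root_embed_mult root_embed_pCons mult_single)
  then show ?case
    using pCons
    by (simp only: sq_subst_pCons root_embed_add root_embed_mult root_embed_const)
      (simp add: root_embed_pCons)
qed simp

lemma root_embed_sq_subst_iterate: "root_embed (j + k) ((sq_subst ^^ j) f) = root_embed k f"
  by (induction j) (simp_all add: root_embed_sq_subst)

text \<open>The finitely many exponents of \<open>a\<close> have a common denominator; levels
  \<open>k\<close> and \<open>l\<close> are both raised to \<open>l + k\<close>.\<close>

lemma root_embedE: obtains k f where "a = root_embed k f"
proof -
  have "\<exists>k f. (\<Sum>q\<in>A. Poly_Mapping.single q (Poly_Mapping.lookup a q)) = root_embed k f"
    if "finite A" for A
    using that
  proof induction
    case empty
    then show ?case by (metis root_embed_0 sum.empty)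
  next
    case (insert q A)
    then obtain k f
      where kf: "(\<Sum>q\<in>A. Poly_Mapping.single q (Poly_Mapping.lookup a q)) = root_embed k f"
      by blast
    obtain l i where q: "q = dyadic_frac l i" by (rule dyadic_fracE)
    have "Poly_Mapping.single q (Poly_Mapping.lookup a q) = root_embed l (monom (Poly_Mapping.lookup a q) i)"
      by (simp add: root_embed_monom q)
    then have "(\<Sum>q\<in>insert q A. Poly_Mapping.single q (Poly_Mapping.lookup a q)) =
        root_embed (l + k) ((sq_subst ^^ k) (monom (Poly_Mapping.lookup a q) i) + (sq_subst ^^ l) f)"
      using insert kf root_embed_sq_subst_iterate[of k l] root_embed_sq_subst_iterate[of l k]
      by (simp add: root_embed_add add.commute)
    then show ?case by blast
  qed
  from this[OF finite_keys, of a] obtain k f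
    where kf: "(\<Sum>q\<in>Poly_Mapping.keys a. Poly_Mapping.single q (Poly_Mapping.lookup a q)) = root_embed k f" by blast
  moreover have "a = (\<Sum>q\<in>Poly_Mapping.keys a. Poly_Mapping.single q (Poly_Mapping.lookup a q))"
    by (intro poly_mapping_eqI)
      (simp add: lookup_sum lookup_single when_def in_keys_iff)
  ultimately have "a = root_embed k f" by (rule trans[rotated])
  then show thesis by (rule that)
qed

lemma is_unit_root_embed: "f dvd 1 \<Longrightarrow> root_embed k f dvd 1"
  using root_embed_mult[of k f] root_embed_1[of k] by (metis dvdE dvd_triv_left)

text \<open>Both factors of a factorisation lie in a common level \<open>j + k\<close>, where
  injectivity of \<open>root_embed\<close> turns it into a factorisation of the j-th iterate of
  \<open>f\<close>.\<close>

lemma irreducible_root_embed: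
  assumes "\<And>j. irreducible ((sq_subst ^^ j) f)"
  shows "irreducible (root_embed k f)"
proof (rule irreducibleI)
  have ne: "f \<noteq> 0" using assms[of 0] by auto
  show "root_embed k f \<noteq> 0"
    using ne root_embed_inject[of k f 0] by auto
  have common: "\<exists>j a' b'. a = root_embed (j + k) a' \<and> b = root_embed (j + k) b'" for a b
  proof -
    obtain l a' where a: "a = root_embed l a'" by (rule root_embedE)
    obtain m b' where b: "b = root_embed m b'" by (rule root_embedE)
    have "a = root_embed (l + m + k) ((sq_subst ^^ (m + k)) a')"
      "b = root_embed (l + m + k) ((sq_subst ^^ (l + k)) b')"
      using a b root_embed_sq_subst_iterate[of "m + k" l a'] root_embed_sq_subst_iterate[of "l + k" m b']
      by (simp_all only: ac_simps)
    then show ?thesis by blast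
  qed
  have split: "\<exists>j a' b'. a = root_embed (j + k) a' \<and> b = root_embed (j + k) b' \<and> (sq_subst ^^ j) g = a' * b'"
    if "root_embed k g = a * b" for a b g
  proof -
    from common[of a b] obtain j a' b' where ab: "a = root_embed (j + k) a'" "b = root_embed (j + k) b'"
      by blast
    then have "root_embed (j + k) ((sq_subst ^^ j) g) = root_embed (j + k) (a' * b')"
      using that by (simp add: root_embed_sq_subst_iterate root_embed_mult)
    then have "(sq_subst ^^ j) g = a' * b'" by (rule root_embed_inject)
    with ab show ?thesis by blast
  qed
  show "\<not> root_embed k f dvd 1"
  proof
    assume "root_embed k f dvd 1"
    then obtain b where "root_embed k 1 = root_embed k f * b"
      unfolding root_embed_1 by (elim dvdE)
    from split[OF this] obtain j a' b' where
      *: "root_embed k f = root_embed (j + k) a'" "(sq_subst ^^ j) 1 = a' * b'" by blast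
    moreover have "(sq_subst ^^ j) 1 = (1 :: rat poly)" by (induction j) simp_all
    moreover have "a' = (sq_subst ^^ j) f"
      using *(1) by (intro root_embed_inject[of "j + k"]) (simp only: root_embed_sq_subst_iterate)
    ultimately have "is_unit ((sq_subst ^^ j) f)" by (metis dvd_triv_left)
    with assms[of j] show False using irreducible_not_unit by blast
  qed
  show "a dvd 1 \<or> b dvd 1" if ab: "root_embed k f = a * b" for a b
  proof -
    from split[OF ab] obtain j a' b' where
      *: "a = root_embed (j + k) a'" "b = root_embed (j + k) b'" "(sq_subst ^^ j) f = a' * b'"
      by blast
    from irreducibleD[OF assms *(3)] show ?thesis
      using * is_unit_root_embed by blast
  qed
qed

lemma poly_to_QM_eq_embed: "poly_to_QM p = root_embed 0 (map_poly of_int p)"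
  by (simp add: poly_to_QM_def root_embed_def coeff_map_poly dyadic_frac_zero degree_map_poly)

text \<open>The second alternative of \<open>atomic\<close>, isolated because it is closed under
  products.\<close>

definition irreducible_product :: "QM \<Rightarrow> bool" where
  "irreducible_product a \<longleftrightarrow> (\<exists>xs. xs \<noteq> [] \<and> (\<forall>x\<in>set xs. irreducible x) \<and> a = prod_list xs)"

lemma irreducible_product_mult:
  assumes "irreducible_product a" "irreducible_product b"
  shows "irreducible_product (a * b)"
proof -
  from assms obtain xs ys where
    "xs \<noteq> []" "\<forall>x\<in>set (xs @ ys). irreducible x" "a * b = prod_list (xs @ ys)"
    unfolding irreducible_product_def by auto
  then show ?thesis
    unfolding irreducible_product_def by (metis append_is_Nil_conv)
qed

lemma irreducible_imp_irreducible_product: "irreducible a \<Longrightarrow> irreducible_product a"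
  unfolding irreducible_product_def by (rule exI[of _ "[a]"]) simp

section \<open>Primitive integer polynomials with bounded roots\<close>

locale unital_hom =
  fixes h :: "'a::comm_ring_1 \<Rightarrow> 'b::comm_ring_1"
  assumes hom_1: "h 1 = 1" and hom_add: "h (x + y) = h x + h y" and hom_mult: "h (x * y) = h x * h y"
begin

lemma hom_0: "h 0 = 0"
  using hom_add[of 0 0] by simp

lemma hom_diff: "h (x - y) = h x - h y"
  using hom_add[of "x - y" y] by (simp add: algebra_simps)

lemma hom_sum: "h (sum g A) = (\<Sum>x\<in>A. h (g x))"
  by (induction A rule: infinite_finite_induct) (simp_all add: hom_0 hom_add)

lemma map_poly_hom_pCons: "map_poly h (pCons a p) = pCons (h a) (map_poly h p)"
  by (rule poly_eqI) (simp add: coeff_map_poly coeff_pCons hom_0 split: nat.split)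

lemma map_poly_hom_add: "map_poly h (p + q) = map_poly h p + map_poly h q"
  by (rule poly_eqI) (simp add: coeff_map_poly hom_0 hom_add)

lemma map_poly_hom_diff: "map_poly h (p - q) = map_poly h p - map_poly h q"
  by (rule poly_eqI) (simp add: coeff_map_poly hom_0 hom_diff)

lemma map_poly_hom_mult: "map_poly h (p * q) = map_poly h p * map_poly h q"
  by (rule poly_eqI) (simp add: coeff_map_poly coeff_mult hom_0 hom_sum hom_mult)

lemma map_poly_hom_smult: "map_poly h (smult c p) = smult (h c) (map_poly h p)"
  by (rule poly_eqI) (simp add: coeff_map_poly hom_0 hom_mult)

lemma map_poly_hom_power: "map_poly h (p ^ n) = map_poly h p ^ n"
  by (induction n) (simp_all add: map_poly_hom_mult hom_1)

lemma map_poly_hom_dvd: "p dvd q \<Longrightarrow> map_poly h p dvd map_poly h q"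
  by (auto simp: map_poly_hom_mult elim!: dvdE)

lemma map_poly_hom_sq_subst: "map_poly h (sq_subst p) = sq_subst (map_poly h p)"
proof (induction p)
  case (pCons c p)
  have "map_poly h [:c:] = [:h c:]" "map_poly h pX = pX"
    by (simp_all add: map_poly_hom_pCons hom_0 hom_1)
  with pCons show ?case
    by (simp only: sq_subst_pCons map_poly_hom_add map_poly_hom_mult map_poly_hom_power map_poly_hom_pCons)
qed simp

lemma map_poly_hom_sq_subst_iterate:
  "map_poly h ((sq_subst ^^ n) p) = (sq_subst ^^ n) (map_poly h p)"
  by (induction n) (simp_all add: map_poly_hom_sq_subst)

end

interpretation of_int_hom: unital_hom of_int
  by unfold_locales simp_all

interpretation of_rat_hom: unital_hom "of_rat :: rat \<Rightarrow> 'a::field_char_0"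
  by unfold_locales (simp_all add: of_rat_add of_rat_mult)

abbreviation of_int_poly :: "int poly \<Rightarrow> 'a::comm_ring_1 poly" where
  "of_int_poly \<equiv> map_poly of_int"

abbreviation of_rat_poly :: "rat poly \<Rightarrow> complex poly" where
  "of_rat_poly \<equiv> map_poly of_rat"

lemma of_rat_of_int_poly: "of_rat_poly (of_int_poly p) = of_int_poly p"
  by (simp add: map_poly_map_poly o_def)

lemma degree_of_int_poly [simp]:
  "degree (of_int_poly p :: 'a::{comm_ring_1,ring_char_0} poly) = degree p"
  by (simp add: degree_map_poly)

lemma degree_of_rat_poly [simp]: "degree (of_rat_poly p) = degree p"
  by (simp add: degree_map_poly)

lemma of_int_poly_eq_iff [simp]:
  "(of_int_poly p :: 'a::{comm_ring_1,ring_char_0} poly) = of_int_poly q \<longleftrightarrow> p = q"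
  by (auto simp: poly_eq_iff coeff_map_poly)

section \<open>Gauss's lemma\<close>

lemma clear_denominators:
  fixes f :: "rat poly"
  obtains d :: int and p where "d \<noteq> 0" "smult (of_int d) f = of_int_poly p"
proof -
  have "\<exists>d p. d \<noteq> 0 \<and> smult (of_int d) f = of_int_poly p"
  proof (induction f)
    case 0
    show ?case by (intro exI[of _ 1] exI[of _ 0]) simp
  next
    case (pCons c f)
    then obtain d p where dp: "d \<noteq> 0" "smult (of_int d) f = of_int_poly p" by blast
    obtain a b where ab: "b > 0" "c = of_int a / of_int b"
      by (metis quotient_of_denom_pos' quotient_of_div surjective_pairing)
    have "smult (of_int (b * d)) (pCons c f) = of_int_poly (pCons (d * a) (smult b p))"
      using ab dp by (simp add: of_int_hom.map_poly_hom_pCons of_int_hom.map_poly_hom_smult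
          smult_smult[symmetric] del: smult_smult)
    with ab dp show ?case by (metis mult_eq_0_iff less_irrefl)
  qed
  then show thesis using that by blast
qed

lemma rat_poly_primitiveE:
  fixes f :: "rat poly"
  assumes "f \<noteq> 0"
  obtains c p where "c \<noteq> 0" "content p = 1" "f = smult c (of_int_poly p)"
proof -
  obtain d q where d: "d \<noteq> 0" "smult (of_int d) f = of_int_poly q" by (rule clear_denominators)
  with assms have q: "q \<noteq> 0" by auto
  have "of_int_poly q = smult (of_int (content q)) (of_int_poly (primitive_part q) :: rat poly)"
    by (metis content_times_primitive_part of_int_hom.map_poly_hom_smult)
  with d have "f = smult (of_int (content q) / of_int d) (of_int_poly (primitive_part q))"
    using d(1) smult_smult[of "inverse (of_int d)" "of_int d" f] unfolding d(2)
    by (simp add: divide_inverse mult.commute)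
  then show thesis
    using that[of "of_int (content q) / of_int d" "primitive_part q"] q d(1) by simp
qed

text \<open>After clearing denominators by \<open>d\<close>, multiplicativity of the content puts
  \<open>d\<close> into the content of the cofactor \<open>r\<close>, where it cancels.\<close>

lemma gauss_dvd:
  fixes g p :: "int poly"
  assumes "content g = 1" "(of_int_poly g :: rat poly) dvd of_int_poly p"
  shows "g dvd p"
proof -
  obtain q where q: "of_int_poly p = of_int_poly g * (q :: rat poly)" using assms(2) by (elim dvdE)
  obtain d r where d: "d \<noteq> 0" "smult (of_int d) q = of_int_poly r" by (rule clear_denominators)
  have "of_int_poly (smult d p) = (of_int_poly (g * r) :: rat poly)"
    by (simp add: of_int_hom.map_poly_hom_smult of_int_hom.map_poly_hom_mult q d(2)[symmetric])
  then have eq: "smult d p = g * r" by simp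
  then have "[:d:] dvd g * r" by (metis dvd_refl smult_dvd_iff const_poly_dvd_iff coeff_smult dvd_triv_left)
  then have "d dvd content r"
    by (simp add: const_poly_dvd_iff_dvd_content content_mult assms(1))
  then have "[:d:] dvd r" by (simp add: const_poly_dvd_iff_dvd_content)
  then obtain s where "r = smult d s" by (auto elim: dvdE)
  with eq have "smult d p = smult d (g * s)" by simp
  with d(1) have "p = g * s" by (simp add: smult_cancel)
  then show ?thesis by simp
qed

lemma irreducible_content:
  fixes p :: "int poly"
  assumes "irreducible p" "degree p > 0"
  shows "content p = 1"
proof -
  have "p = [:content p:] * primitive_part p" by simp
  with assms(1) have "is_unit [:content p:] \<or> is_unit (primitive_part p)" by (rule irreducibleD)
  moreover have "\<not> is_unit (primitive_part p)"
  proof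
    assume "is_unit (primitive_part p)"
    then have "degree (primitive_part p) = 0" by (metis degree_pCons_0 is_unit_poly_iff)
    with assms(2) show False by simp
  qed
  ultimately show ?thesis by (metis const_poly_dvd_iff_dvd_content content_1 is_unit_content_iff)
qed

text \<open>A rational factor is a multiple of a primitive integer one, which divides
  \<open>p\<close> by \<open>gauss_dvd\<close>.\<close>

lemma irreducible_of_int_poly:
  fixes p :: "int poly"
  assumes "irreducible p" "degree p > 0"
  shows "irreducible (of_int_poly p :: rat poly)"
proof (rule irreducibleI)
  let ?p = "of_int_poly p :: rat poly"
  show nz: "?p \<noteq> 0" using assms by (metis degree_0 degree_of_int_poly less_irrefl)
  show "\<not> is_unit ?p" using nz assms(2) by (auto simp: is_unit_iff_degree)
  fix a b assume ab: "?p = a * b"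
  with nz have "a \<noteq> 0" "b \<noteq> 0" by auto
  obtain c q where q: "c \<noteq> 0" "content q = 1" "a = smult c (of_int_poly q)"
    using \<open>a \<noteq> 0\<close> by (rule rat_poly_primitiveE)
  have "q dvd p" using q ab by (intro gauss_dvd) (auto intro: dvd_smult)
  then obtain r where r: "p = q * r" by (elim dvdE)
  then have "q \<noteq> 0" "r \<noteq> 0" using nz by auto
  have dp: "degree p = degree a + degree b"
    using ab \<open>a \<noteq> 0\<close> \<open>b \<noteq> 0\<close> by (metis degree_mult_eq degree_of_int_poly)
  have "degree a = degree q" using q by simp
  moreover have "degree p = degree q + degree r"
    using r \<open>q \<noteq> 0\<close> \<open>r \<noteq> 0\<close> by (simp add: degree_mult_eq)
  moreover have "degree q = 0 \<or> degree r = 0"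
    using irreducibleD[OF assms(1) r] by (auto simp: is_unit_poly_iff)
  ultimately show "is_unit a \<or> is_unit b"
    using dp \<open>a \<noteq> 0\<close> \<open>b \<noteq> 0\<close> by (auto simp: is_unit_iff_degree)
qed

text \<open>Splitting off a root of norm at most R costs at most a factor 1 + R in the coefficient
  bound.\<close>

lemma norm_coeff_le_roots:
  fixes p :: "complex poly"
  assumes "\<And>z. poly p z = 0 \<Longrightarrow> norm z \<le> R" "R \<ge> 0"
  shows "norm (coeff p i) \<le> norm (lead_coeff p) * (1 + R) ^ degree p"
  using assms(1)
proof (induction "degree p" arbitrary: p i)
  case 0
  then show ?case by (cases i) (auto elim: degree_eq_zeroE)
next
  case (Suc n)
  then have "\<not> constant (poly p)" by (simp add: constant_degree)
  then obtain z where z: "poly p z = 0" using fundamental_theorem_of_algebra by blast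
  then obtain q where q: "p = [:- z, 1:] * q" by (metis dvdE poly_eq_0_iff_dvd)
  have q0: "q \<noteq> 0" using q Suc by auto
  have dq: "degree p = Suc (degree q)" using q q0 by (simp add: degree_mult_eq del: mult_pCons_left)
  have lc: "lead_coeff p = lead_coeff q" using q by (simp add: lead_coeff_mult del: mult_pCons_left)
  have IH: "norm (coeff q j) \<le> norm (lead_coeff q) * (1 + R) ^ degree q" for j
    using Suc.hyps(2) dq Suc.prems q by (intro Suc.hyps(1)) auto
  have "coeff p i = (if i = 0 then 0 else coeff q (i - 1)) - z * coeff q i"
    by (cases i) (simp_all add: q)
  \<comment> \<open>For i = 0 the truncated index i - 1 is 0, and the extra summand only weakens the
    bound.\<close>
  then have "norm (coeff p i) \<le> norm (coeff q (i - 1)) + norm z * norm (coeff q i)"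
    by (auto simp: norm_mult[symmetric] intro: order.trans[OF norm_triangle_ineq4])
  also have "\<dots> \<le> norm (lead_coeff q) * (1 + R) ^ degree q
      + R * (norm (lead_coeff q) * (1 + R) ^ degree q)"
    using Suc.prems[OF z] assms(2) by (intro add_mono mult_mono IH) auto
  also have "\<dots> = norm (lead_coeff p) * (1 + R) ^ degree p"
    unfolding lc unfolding dq by (simp add: algebra_simps)
  finally show ?case .
qed

lemma finite_int_polys_bounded_coeffs:
  "finite {p :: int poly. degree p \<le> n \<and> (\<forall>i. \<bar>coeff p i\<bar> \<le> B)}"
proof (rule finite_subset)
  show "{p. degree p \<le> n \<and> (\<forall>i. \<bar>coeff p i\<bar> \<le> B)} \<subseteq>
      Poly ` {xs. set xs \<subseteq> {- B..B} \<and> length xs \<le> Suc n}"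
  proof
    fix p :: "int poly" assume "p \<in> {p. degree p \<le> n \<and> (\<forall>i. \<bar>coeff p i\<bar> \<le> B)}"
    then have "coeffs p \<in> {xs. set xs \<subseteq> {- B..B} \<and> length xs \<le> Suc n}"
      by (auto simp: coeffs_def abs_le_iff minus_le_iff[of _ B])
    then show "p \<in> Poly ` {xs. set xs \<subseteq> {- B..B} \<and> length xs \<le> Suc n}"
      by (intro image_eqI[of _ _ "coeffs p"]) simp_all
  qed
  show "finite (Poly ` {xs. set xs \<subseteq> {- B..B} \<and> length xs \<le> Suc n})"
    by (intro finite_imageI finite_lists_length_le) simp
qed

text \<open>Northcott-style finiteness: \<open>lead_coeff p\<close> is bounded as a divisor of
  \<open>c\<close>, hence so are all coefficients.\<close>

lemma finite_int_polys_bounded_roots: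
  fixes c :: int
  assumes "c \<noteq> 0" "R \<ge> 0"
  shows "finite {p :: int poly. degree p \<le> n \<and> lead_coeff p dvd c \<and>
    (\<forall>z::complex. poly (of_int_poly p) z = 0 \<longrightarrow> norm z \<le> R)}" (is "finite ?S")
proof (rule finite_subset[OF _ finite_int_polys_bounded_coeffs])
  show "?S \<subseteq> {p. degree p \<le> n \<and> (\<forall>i. \<bar>coeff p i\<bar> \<le> \<lceil>of_int \<bar>c\<bar> * (1 + R) ^ n\<rceil>)}"
  proof (safe)
    fix p :: "int poly" and i
    assume p: "degree p \<le> n" "lead_coeff p dvd c"
      "\<forall>z::complex. poly (of_int_poly p) z = 0 \<longrightarrow> norm z \<le> R"
    have "of_int \<bar>coeff p i\<bar> = norm (coeff (of_int_poly p :: complex poly) i)"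
      by (simp add: coeff_map_poly)
    also have "\<dots> \<le> norm (lead_coeff (of_int_poly p :: complex poly)) * (1 + R) ^ degree p"
      using norm_coeff_le_roots[of "of_int_poly p" R i] p(3) assms(2) by simp
    also have "norm (lead_coeff (of_int_poly p :: complex poly)) = of_int \<bar>lead_coeff p\<bar>"
      by (simp add: coeff_map_poly)
    also have "of_int \<bar>lead_coeff p\<bar> * (1 + R) ^ degree p \<le> of_int \<bar>c\<bar> * (1 + R) ^ n"
      using assms p(1,2) dvd_imp_le_int[of c "lead_coeff p"]
      by (intro mult_mono power_increasing) auto
    finally show "\<bar>coeff p i\<bar> \<le> \<lceil>of_int \<bar>c\<bar> * (1 + R) ^ n\<rceil>"
      by (simp add: le_ceiling_iff)
  qed
qed

section \<open>Infinite splitting chains\<close>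

lemma coeff_0_sq_subst_iterate [simp]: "coeff ((sq_subst ^^ n) p) 0 = coeff p 0"
  by (induction n) simp_all

lemma sq_subst_iterate_dvd: "p dvd q \<Longrightarrow> (sq_subst ^^ n) p dvd (sq_subst ^^ n) q"
  by (induction n) (simp_all add: sq_subst_dvd)

lemma poly_sq_subst_iterate: "poly ((sq_subst ^^ n) p) z = poly p (z ^ 2 ^ n)"
  by (induction n arbitrary: z) (simp_all add: power_mult)

lemma lead_coeff_sq_subst_iterate:
  "lead_coeff ((sq_subst ^^ n) p) = lead_coeff (p :: 'a::idom poly)"
proof (induction n)
  case (Suc n)
  have "lead_coeff (sq_subst p) = lead_coeff p" for p :: "'a poly"
    by (simp add: sq_subst_def lead_coeff_comp degree_monom_eq)
  with Suc show ?case by simp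
qed simp

text \<open>The disjunction records whether the one permitted doubling of the degree beyond
  \<open>d\<close> is still available. Once it is spent, -1 is a square in Q[x]/(f), which rules out
  another.\<close>

definition splitting :: "nat \<Rightarrow> nat \<Rightarrow> rat poly \<Rightarrow> bool" where
  "splitting d k f \<longleftrightarrow> irreducible f \<and> coeff f 0 \<noteq> 0 \<and> \<not> irreducible_product (root_embed k f) \<and>
     (degree f \<le> d \<or> degree f \<le> 2 * d \<and> (\<exists>s. f dvd s ^ 2 + 1))"

text \<open>Since \<open>irreducible_product\<close> is closed under products, one factor inherits
  its failure. The degree condition covers every divisor of the right degree, so that either factor
  qualifies.\<close>

lemma splitting_factor:
  assumes "splitting d k f" "(sq_subst ^^ j) f = g * t" "irreducible g" "irreducible t"
    "\<And>h. h dvd (sq_subst ^^ j) f \<Longrightarrow> degree h = degree g \<Longrightarrow>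
      degree h \<le> d \<or> degree h \<le> 2 * d \<and> (\<exists>s. h dvd s ^ 2 + 1)"
    "degree t = degree g"
  obtains h where "splitting d (j + k) h" "h dvd (sq_subst ^^ j) f"
proof -
  have "root_embed k f = root_embed (j + k) g * root_embed (j + k) t"
    by (metis assms(2) root_embed_mult root_embed_sq_subst_iterate)
  with assms(1) have "\<not> irreducible_product (root_embed (j + k) g) \<or>
      \<not> irreducible_product (root_embed (j + k) t)"
    unfolding splitting_def by (metis irreducible_product_mult)
  moreover have "coeff (g * t) 0 \<noteq> 0"
    using assms(1) by (simp flip: assms(2) add: splitting_def)
  then have "coeff g 0 \<noteq> 0" "coeff t 0 \<noteq> 0" by (auto simp: coeff_mult_0)
  ultimately show thesis
    using assms(3-6) that[of g] that[of t] unfolding splitting_def assms(2) by auto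
qed

text \<open>If \<open>f(x\<^sup>2)\<close> splits, its factors have the same degree as \<open>f\<close>. If it does not, then \<open>f(x\<^sup>4)\<close>
  must split, the degree of the factors doubles, and \<open>-1\<close> becomes a square; this can happen only once.\<close>

lemma splitting_step:
  assumes "splitting d k f"
  obtains j g where "j > 0" "splitting d (j + k) g" "g dvd (sq_subst ^^ j) f"
proof -
  have f: "irreducible f" "coeff f 0 \<noteq> 0" "\<not> irreducible_product (root_embed k f)"
    and deg: "degree f \<le> d \<or> degree f \<le> 2 * d \<and> (\<exists>s. f dvd s ^ 2 + 1)"
    using assms by (auto simp: splitting_def)
  show thesis
  proof (cases "irreducible (sq_subst f)")
    case False
    with f(1) obtain g t where gt: "sq_subst f = g * t" "irreducible g" "irreducible t"
      "degree g = degree f" "degree t = degree f" by (rule sq_subst_reducibleE)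
    have "degree h \<le> d \<or> degree h \<le> 2 * d \<and> (\<exists>s. h dvd s ^ 2 + 1)"
      if h: "h dvd (sq_subst ^^ 1) f" "degree h = degree g" for h
    proof (cases "degree f \<le> d")
      case False
      with deg obtain s where s: "degree f \<le> 2 * d" "f dvd s ^ 2 + 1" by blast
      \<comment> \<open>A square root s of -1 modulo f becomes s(x^2) modulo f(x^2), hence modulo
        each factor.\<close>
      then have "sq_subst f dvd sq_subst s ^ 2 + 1"
        using sq_subst_dvd[of f "s ^ 2 + 1"] by simp
      moreover have "h dvd sq_subst f" using h(1) by simp
      ultimately have "h dvd sq_subst s ^ 2 + 1" by (rule dvd_trans[rotated])
      with h(2) s(1) gt(4) show ?thesis by auto
    qed (use h gt in simp)
    moreover have "(sq_subst ^^ 1) f = g * t" "degree t = degree g"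
      using gt by simp_all
    ultimately obtain h where "splitting d (1 + k) h" "h dvd (sq_subst ^^ 1) f"
      using splitting_factor[OF assms _ gt(2,3)] by blast
    then show thesis using that[of 1] by simp
  next
    case f2: True
    \<comment> \<open>Otherwise all iterates would be irreducible, and f would be irreducible in the
      monoid algebra.\<close>
    have "\<not> irreducible (sq_subst (sq_subst f))"
      using f irreducible_imp_irreducible_product irreducible_root_embed
        irreducible_sq_subst_iterate[OF f(2,1) f2] by blast
    \<comment> \<open>A square root of -1 would make f(x^4) irreducible, so the doubling is
      unspent.\<close>
    moreover from this have "\<not> (\<exists>s. f dvd s ^ 2 + 1)"
      using irreducible_sq_subst2_if_imaginary[OF f(1,2) _ f2] by blast
    ultimately have f4: "\<not> irreducible (sq_subst (sq_subst f))" and deg: "degree f \<le> d"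
      using deg by blast+
    obtain g t where gt: "sq_subst (sq_subst f) = g * t" "irreducible g" "irreducible t"
        "degree g = degree (sq_subst f)" "degree t = degree (sq_subst f)"
      using f2 f4 by (rule sq_subst_reducibleE)
    obtain w s where s: "sq_subst f dvd s ^ 2 + 1"
      using f(2) f2 f4 by (rule capelli_4)
    have f_iter: "(sq_subst ^^ 2) f = sq_subst (sq_subst f)"
      by (simp add: numeral_2_eq_2)
    have "sq_subst (sq_subst f) dvd sq_subst s ^ 2 + 1"
      using sq_subst_dvd[OF s] by simp
    then have "degree h \<le> d \<or> degree h \<le> 2 * d \<and> (\<exists>s. h dvd s ^ 2 + 1)"
      if "h dvd (sq_subst ^^ 2) f" "degree h = degree g" for h
      using that deg gt(4) dvd_trans[of h "sq_subst (sq_subst f)"] by (auto simp: f_iter)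
    moreover have "(sq_subst ^^ 2) f = g * t" "degree t = degree g"
      using gt f_iter by simp_all
    ultimately obtain h where "splitting d (2 + k) h" "h dvd (sq_subst ^^ 2) f"
      using splitting_factor[OF assms _ gt(2,3)] by blast
    then show thesis using that[of 2] by simp
  qed
qed

lemma splitting_chain:
  assumes "splitting d 0 f"
  obtains F where "F 0 = f" "\<And>n. irreducible (F n)" "\<And>n. degree (F n) \<le> 2 * d"
    "\<And>n. \<exists>j>0. F (Suc n) dvd (sq_subst ^^ j) (F n)"
proof -
  \<comment> \<open>Dependent choice runs over pairs of a level and a polynomial; the clause for n =
    0 pins the start.\<close>
  define I where "I n x \<longleftrightarrow> splitting d (fst x) (snd x) \<and> (n = 0 \<longrightarrow> snd x = f)"
    for n :: nat and x :: "nat \<times> rat poly"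
  have "\<exists>G. \<forall>n. I n (G n) \<and> (\<exists>j>0. snd (G (Suc n)) dvd (sq_subst ^^ j) (snd (G n)))"
  proof (rule dependent_nat_choice)
    show "\<exists>x. I 0 x"
      using assms by (auto simp: I_def)
  next
    fix x n
    assume "I n x"
    then have "splitting d (fst x) (snd x)" by (simp add: I_def)
    then obtain j g where "j > 0" "splitting d (j + fst x) g" "g dvd (sq_subst ^^ j) (snd x)"
      by (rule splitting_step)
    then show "\<exists>y. I (Suc n) y \<and> (\<exists>j>0. snd y dvd (sq_subst ^^ j) (snd x))"
      by (intro exI[of _ "(j + fst x, g)"]) (auto simp: I_def)
  qed
  then obtain G where G: "\<And>n. I n (G n)"
      "\<And>n. \<exists>j>0. snd (G (Suc n)) dvd (sq_subst ^^ j) (snd (G n))"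
    by blast
  have split: "splitting d (fst (G n)) (snd (G n))" for n
    using G(1)[of n] by (simp add: I_def)
  show thesis
  proof (rule that[of "snd \<circ> G"])
    show "(snd \<circ> G) 0 = f" using G(1)[of 0] by (simp add: I_def)
    show "irreducible ((snd \<circ> G) n)" "degree ((snd \<circ> G) n) \<le> 2 * d" for n
      using split[of n] by (auto simp: splitting_def)
    show "\<exists>j>0. (snd \<circ> G) (Suc n) dvd (sq_subst ^^ j) ((snd \<circ> G) n)" for n
      using G(2) by simp
  qed
qed

section \<open>From a repetition in the chain to a root of odd order\<close>

lemma sq_subst_chain_dvd:
  assumes "\<And>n. \<exists>j>0. F (Suc n) dvd (sq_subst ^^ j) (F n)" "m < n"
  shows "\<exists>j>0. F n dvd (sq_subst ^^ j) (F m)"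
  using assms(2)
proof (induction n)
  case (Suc n)
  show ?case
  proof (cases "m = n")
    case False
    with Suc obtain i where i: "i > 0" "F n dvd (sq_subst ^^ i) (F m)" by auto
    from assms(1) obtain j where j: "j > 0" "F (Suc n) dvd (sq_subst ^^ j) (F n)" by blast
    have "F (Suc n) dvd (sq_subst ^^ (j + i)) (F m)"
      using j(2) sq_subst_iterate_dvd[OF i(2), of j] by (auto simp: funpow_add intro: dvd_trans)
    with i(1) show ?thesis by (intro exI[of _ "j + i"]) simp
  qed (use assms(1) in simp)
qed simp

text \<open>An orbit in a finite set may have a tail before its cycle, so \<open>w\<close> is the
  earlier of two coinciding iterates.\<close>

lemma power_self_map_periodic:
  fixes Z :: "complex set"
  assumes "finite Z" "z \<in> Z" "\<And>z. z \<in> Z \<Longrightarrow> z ^ q \<in> Z"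
  obtains w e where "w \<in> Z" "e > 0" "w ^ q ^ e = w"
proof -
  have iter: "z ^ q ^ n \<in> Z" for n
    using assms(2,3) by (induction n) (simp_all add: power_mult mult.commute[of q])
  have "\<not> inj (\<lambda>n. z ^ q ^ n)"
    using finite_subset[OF _ assms(1), of "range (\<lambda>n. z ^ q ^ n)"] iter range_inj_infinite by blast
  then obtain a b where "a < b" "z ^ q ^ a = z ^ q ^ b"
    unfolding inj_def by (metis linorder_neqE_nat)
  moreover have "(z ^ q ^ a) ^ q ^ (b - a) = z ^ q ^ (a + (b - a))"
    by (simp only: power_mult power_add)
  ultimately show thesis
    using that[of "z ^ q ^ a" "b - a"] iter[of a] by simp
qed

lemma odd_order_root:
  fixes P :: "int poly"
  assumes P: "irreducible P" "degree P > 0" "coeff P 0 \<noteq> 0"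
    and red: "\<not> irreducible_product (poly_to_QM P)"
  obtains z :: complex and N where "poly (of_int_poly P) z = 0" "z ^ N = 1" "odd N"
proof -
  define d where "d = degree P"
  define f :: "rat poly" where "f = of_int_poly P"
  have "splitting d 0 f"
    using P red irreducible_of_int_poly[of P]
    by (simp add: splitting_def d_def f_def coeff_map_poly poly_to_QM_eq_embed)
  then obtain F where F: "F 0 = f" "\<And>n. irreducible (F n)" "\<And>n. degree (F n) \<le> 2 * d"
    and step: "\<And>n. \<exists>j>0. F (Suc n) dvd (sq_subst ^^ j) (F n)"
    using splitting_chain by blast
  have F_dvd: "\<exists>k. F n dvd (sq_subst ^^ k) f" for n
  proof (cases n)
    case 0
    then show ?thesis using F(1) by (auto intro: exI[of _ 0])
  qed (use sq_subst_chain_dvd[of F, OF step, of 0 n] F(1) in auto)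

  define Z where "Z = {z::complex. poly (of_int_poly P) z = 0}"
  have "of_int_poly P \<noteq> (0 :: complex poly)" using P(2) by (metis degree_0 degree_of_int_poly less_irrefl)
  then have "finite Z" unfolding Z_def by (rule poly_roots_finite)
  \<comment> \<open>As R is at least 1, a point outside the disc of radius R stays outside under
    squaring.\<close>
  define R where "R = Max (insert 1 (norm ` Z))"
  have R: "R \<ge> 1" "\<And>z. z \<in> Z \<Longrightarrow> norm z \<le> R"
    using \<open>finite Z\<close> by (auto simp: R_def)
  define S where "S = {p :: int poly. degree p \<le> 2 * d \<and> lead_coeff p dvd lead_coeff P \<and>
    (\<forall>z::complex. poly (of_int_poly p) z = 0 \<longrightarrow> norm z \<le> R)}"
  have "finite S"
    unfolding S_def using P(2) R(1) by (intro finite_int_polys_bounded_roots) auto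
  have "\<exists>p\<in>S. \<exists>c. c \<noteq> 0 \<and> F n = smult c (of_int_poly p)" for n
  proof -
    have "F n \<noteq> 0" using F(2)[of n] by auto
    then obtain c p where p: "c \<noteq> 0" "content p = 1" "F n = smult c (of_int_poly p)"
      by (rule rat_poly_primitiveE)
    from F_dvd obtain k where k: "F n dvd (sq_subst ^^ k) f" by blast
    then have "of_int_poly p dvd (of_int_poly ((sq_subst ^^ k) P) :: rat poly)"
      using p by (simp add: f_def of_int_hom.map_poly_hom_sq_subst_iterate smult_dvd_iff)
    with p(2) have dvd: "p dvd (sq_subst ^^ k) P" by (rule gauss_dvd)
    have "lead_coeff p dvd lead_coeff P"
      using dvd lead_coeff_sq_subst_iterate[of k P] by (metis dvd_def lead_coeff_mult)
    moreover have "norm z \<le> R" if z: "poly (of_int_poly p) z = 0" for z :: complex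
    proof (rule ccontr)
      assume "\<not> norm z \<le> R"
      then have *: "norm z > R" by simp
      have "(of_int_poly p :: complex poly) dvd (sq_subst ^^ k) (of_int_poly P)"
        using of_int_hom.map_poly_hom_dvd[OF dvd] by (simp add: of_int_hom.map_poly_hom_sq_subst_iterate)
      with z have "z ^ 2 ^ k \<in> Z"
        unfolding Z_def by (auto simp: poly_sq_subst_iterate elim!: dvdE)
          (metis mult_zero_left poly_mult poly_sq_subst_iterate)
      from R(2)[OF this] have "norm z ^ 2 ^ k \<le> R" by (simp add: norm_power)
      moreover have "norm z ^ 1 \<le> norm z ^ 2 ^ k"
        using * R(1) by (intro power_increasing) auto
      ultimately show False using * by simp
    qed
    moreover have "degree p \<le> 2 * d" using F(3)[of n] p by simp
    ultimately show ?thesis using p by (auto simp: S_def)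
  qed
  then obtain p c where p: "\<And>n. p n \<in> S" "\<And>n. c n \<noteq> 0" "\<And>n. F n = smult (c n) (of_int_poly (p n))"
    by metis
  have "\<not> inj p"
    using finite_subset[OF _ \<open>finite S\<close>, of "range p"] p(1) range_inj_infinite by blast
  then obtain m n where mn: "m < n" "p m = p n"
    unfolding inj_def by (metis linorder_neqE_nat)
  define g where "g = of_rat_poly (F m)"
  \<comment> \<open>Both are nonzero rational multiples of the same integer polynomial; this closes
    the chain into a loop.\<close>
  have "F m dvd F n"
    using p(2,3) mn(2) by (simp add: smult_dvd_iff dvd_smult)
  moreover from sq_subst_chain_dvd[of F, OF step mn(1)] obtain j
    where "j > 0" "F n dvd (sq_subst ^^ j) (F m)" by blast
  ultimately have "F m dvd (sq_subst ^^ j) (F m)" by (blast intro: dvd_trans)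
  then have g_dvd: "g dvd (sq_subst ^^ j) g"
    unfolding g_def using of_rat_hom.map_poly_hom_dvd
    by (metis of_rat_hom.map_poly_hom_sq_subst_iterate)
  from F_dvd obtain k where "F m dvd (sq_subst ^^ k) f" by blast
  then have g_dvd_P: "g dvd (sq_subst ^^ k) (of_int_poly P)"
    unfolding g_def f_def using of_rat_hom.map_poly_hom_dvd
    by (metis of_rat_hom.map_poly_hom_sq_subst_iterate of_rat_of_int_poly)
  have dg: "degree g > 0" unfolding g_def using irreducible_degree_pos[OF F(2)] by simp
  then have "finite {z. poly g z = 0}" by (intro poly_roots_finite) auto
  moreover obtain z where "poly g z = 0"
    using fundamental_theorem_of_algebra dg by (metis constant_degree less_irrefl)
  \<comment> \<open>Since g divides g(x^(2^j)), the 2^j-th power map sends roots of g to roots of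
    g.\<close>
  moreover have "poly g (z ^ 2 ^ j) = 0" if "poly g z = 0" for z
    using that g_dvd by (metis dvd_trans poly_eq_0_iff_dvd poly_sq_subst_iterate)
  ultimately obtain w e where w: "poly g w = 0" and e: "e > 0" "w ^ (2 ^ j) ^ e = w"
    using power_self_map_periodic[of "{z. poly g z = 0}" z "2 ^ j"] by auto
  define z where "z = w ^ 2 ^ k"
  have root: "poly (of_int_poly P) z = 0"
    unfolding z_def using w g_dvd_P by (metis dvd_trans poly_eq_0_iff_dvd poly_sq_subst_iterate)
  have "w \<noteq> 0"
  proof
    assume "w = 0"
    with root have "poly (of_int_poly P) (0 :: complex) = 0" by (simp add: z_def power_0_left)
    with P(3) show False by (simp add: coeff_map_poly poly_0_coeff_0)
  qed
  \<comment> \<open>Cancelling the nonzero w leaves this exponent, odd because j and e are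
    positive.\<close>
  define N where "N = (2 ^ j) ^ e - (1 :: nat)"
  have "odd N"
    using \<open>j > 0\<close> \<open>e > 0\<close> by (simp add: N_def)
  have "w ^ Suc N = w" using e by (simp add: N_def)
  with \<open>w \<noteq> 0\<close> have "w ^ N = 1" by simp
  then have "z ^ N = 1" unfolding z_def by (metis power_mult mult.commute power_one)
  with root \<open>odd N\<close> show thesis by (intro that)
qed

section \<open>Irreducibility of cyclotomic polynomials\<close>

text \<open>\<open>p\<close> divides the inner binomial coefficients. The general ring serves both Z
  and Z[x].\<close>

lemma freshmans_dream_dvd:
  fixes x y :: "'a::comm_ring_1"
  assumes "prime p"
  shows "of_nat p dvd (x + y) ^ p - (x ^ p + y ^ p)"
proof -
  have p: "p > 0" using assms by (rule prime_gt_0_nat)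
  have "(x + y) ^ p = (\<Sum>k\<le>p. of_nat (p choose k) * x ^ k * y ^ (p - k))"
    by (rule binomial_ring)
  also have "{..p} = insert 0 (insert p {0<..<p})" using p by auto
  also have "(\<Sum>k\<in>insert 0 (insert p {0<..<p}). of_nat (p choose k) * x ^ k * y ^ (p - k)) =
      y ^ p + (x ^ p + (\<Sum>k\<in>{0<..<p}. of_nat (p choose k) * x ^ k * y ^ (p - k)))"
    using p by simp
  finally have eq: "(x + y) ^ p - (x ^ p + y ^ p) =
      (\<Sum>k\<in>{0<..<p}. of_nat (p choose k) * x ^ k * y ^ (p - k))" by simp
  have "of_nat p dvd (of_nat (p choose k) * x ^ k * y ^ (p - k) :: 'a)"
    if "k \<in> {0<..<p}" for k
  proof -
    have "p dvd p choose k" using that assms by (intro dvd_choose_prime) auto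
    then have "of_nat p dvd (of_nat (p choose k) :: 'a)" by (auto elim!: dvdE)
    then show ?thesis by (intro dvd_mult2)
  qed
  then show ?thesis unfolding eq by (rule dvd_sum)
qed

lemma fermat_dvd:
  assumes "prime p"
  shows "int p dvd a ^ p - a"
proof (induction a rule: int_induct[where k = 0])
  case base
  show ?case using prime_gt_0_nat[OF assms] by (simp add: power_0_left)
next
  case (step1 i)
  have "(i + 1) ^ p - (i + 1) = ((i + 1) ^ p - (i ^ p + 1 ^ p)) + (i ^ p - i)" by simp
  with step1 freshmans_dream_dvd[OF assms, of i 1] show ?case by (metis dvd_add of_nat_id of_nat_eq_iff)
next
  case (step2 i)
  have "(i - 1) ^ p - (i - 1) = (i ^ p - i) - ((i - 1 + 1) ^ p - ((i - 1) ^ p + 1 ^ p))" by simp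
  with step2 freshmans_dream_dvd[OF assms, of "i - 1" 1] show ?case by (metis dvd_diff of_nat_id)
qed

text \<open>Frobenius modulo \<open>p\<close>: freshman's dream separates the constant term from the
  rest, and Fermat's little theorem treats the constants.\<close>

lemma frobenius_int_poly:
  fixes h :: "int poly"
  assumes "prime p"
  shows "of_nat p dvd pcompose h (monom 1 p) - h ^ p"
proof (induction h)
  case 0
  show ?case using prime_gt_0_nat[OF assms] by (simp add: power_0_left)
next
  case (pCons a h)
  let ?X = "[:0, 1:] :: int poly" and ?M = "monom 1 p :: int poly"
  have "int p dvd a - a ^ p"
    using fermat_dvd[OF assms, of a] by (simp add: dvd_diff_commute)
  then have const: "of_nat p dvd [:a:] - [:a:] ^ p"
    by (auto simp: of_nat_poly poly_const_pow elim!: dvdE)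
  have fresh: "of_nat p dvd ([:a:] + ?X * h) ^ p - ([:a:] ^ p + (?X * h) ^ p)"
    by (rule freshmans_dream_dvd) fact
  have "pCons a h = [:a:] + ?X * h" by simp
  moreover have "pcompose (pCons a h) ?M = [:a:] + ?X ^ p * pcompose h ?M"
    by (simp add: pcompose_pCons monom_altdef)
  ultimately have "pcompose (pCons a h) ?M - pCons a h ^ p =
      ([:a:] - [:a:] ^ p) + ?X ^ p * (pcompose h ?M - h ^ p)
      - (([:a:] + ?X * h) ^ p - ([:a:] ^ p + (?X * h) ^ p))"
    unfolding power_mult_distrib by (simp only: algebra_simps)
  then show ?case
    using const fresh pCons.IH by (metis dvd_add dvd_diff dvd_mult)
qed

text \<open>Over F_p, \<open>P\<close> keeps its positive degree, so it divides no nonzero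
  constant.\<close>

lemma prime_dvd_const_if_dvd_mod:
  fixes P t r :: "int poly"
  assumes p: "prime p" and P: "degree P > 0" "\<not> p dvd lead_coeff P"
    and eq: "P * t = [:c:] + smult p r"
  shows "p dvd c"
proof -
  \<comment> \<open>The coefficients of \<open>t0\<close> are reduced residues, so p divides its
    leading one only if that vanishes.\<close>
  define t0 t1 where "t0 = map_poly (\<lambda>x. x mod p) t" and "t1 = map_poly (\<lambda>x. x div p) t"
  have t: "t = t0 + smult p t1"
    by (rule poly_eqI) (simp add: t0_def t1_def coeff_map_poly)
  have "P * t0 = [:c:] + smult p (r - P * t1)"
    using eq by (simp add: t algebra_simps smult_diff_right)
  then have coeff: "coeff (P * t0) i = coeff [:c:] i + p * coeff (r - P * t1) i" for i
    by simp
  have "t0 = 0"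
  proof (rule ccontr)
    assume "t0 \<noteq> 0"
    have "coeff (P * t0) (degree P + degree t0) = lead_coeff P * lead_coeff t0"
      by (rule coeff_mult_degree_sum)
    moreover have "coeff [:c:] (degree P + degree t0) = 0"
      using P(1) by (simp add: coeff_pCons split: nat.split)
    ultimately have "p dvd lead_coeff P * lead_coeff t0"
      using coeff[of "degree P + degree t0"] by (metis add_0 dvd_triv_left)
    with p P(2) have "p dvd lead_coeff t0" by (auto simp: prime_dvd_mult_iff)
    moreover have "lead_coeff t0 mod p = lead_coeff t0" by (simp add: t0_def coeff_map_poly)
    ultimately have "lead_coeff t0 = 0" by (metis mod_eq_0_iff_dvd)
    with \<open>t0 \<noteq> 0\<close> show False by simp
  qed
  with coeff[of 0] have "c = - p * coeff (r - P * t1) 0" by simp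
  then show ?thesis by simp
qed

text \<open>Otherwise \<open>Q\<close> is invertible modulo \<open>P\<close> over the rationals, and
  evaluating the Bezout relation at \<open>z\<close> gives -1 = 0.\<close>

lemma irreducible_dvd_if_common_root:
  fixes P Q :: "int poly" and z :: complex
  assumes P: "irreducible P" "degree P > 0"
    and z: "poly (of_int_poly P) z = 0" "poly (of_int_poly Q) z = 0"
  shows "P dvd Q"
proof -
  have "(of_int_poly P :: rat poly) dvd of_int_poly Q"
  proof (rule ccontr)
    assume "\<not> (of_int_poly P :: rat poly) dvd of_int_poly Q"
    then obtain v :: "rat poly" where "of_int_poly P dvd of_int_poly Q * v - 1"
      using irreducible_inverse_mod[OF irreducible_of_int_poly[OF P]] by blast
    then have "of_rat_poly (of_int_poly P) dvd of_rat_poly (of_int_poly Q * v - 1)"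
      by (rule of_rat_hom.map_poly_hom_dvd)
    then have "of_int_poly P dvd of_int_poly Q * of_rat_poly v - 1"
      by (simp add: of_rat_hom.map_poly_hom_diff of_rat_hom.map_poly_hom_mult
          of_rat_hom.hom_1 of_rat_of_int_poly)
    then have "poly (of_int_poly Q * of_rat_poly v - 1) z = 0"
      using z(1) by (metis dvd_trans poly_eq_0_iff_dvd)
    with z(2) show False by simp
  qed
  with irreducible_content[OF P] show ?thesis by (rule gauss_dvd)
qed

lemma of_int_poly_monom_minus_1 [simp]:
  "(of_int_poly (monom 1 n - 1) :: complex poly) = monom 1 n - 1"
  by (simp add: of_int_hom.map_poly_hom_diff map_poly_monom)

lemma of_int_poly_pcompose_monom:
  "(of_int_poly (pcompose h (monom 1 p)) :: complex poly) = pcompose (of_int_poly h) (monom 1 p)"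
  by (induction h) (simp_all add: pcompose_pCons of_int_hom.map_poly_hom_pCons
      of_int_hom.map_poly_hom_add of_int_hom.map_poly_hom_mult map_poly_monom)

lemma lead_coeff_monom_minus_1: "n > 0 \<Longrightarrow> lead_coeff (monom 1 n - 1 :: int poly) = 1"
  using lead_coeff_add_le[of "- 1" "monom 1 n :: int poly"] by (simp add: degree_monom_eq)

text \<open>Dedekind's argument: otherwise \<open>w\<^sup>p\<close> is a root of the cofactor \<open>h\<close> of \<open>P\<close> in \<open>x\<^sup>n - 1\<close>, so \<open>h\<^sup>p\<close>
  vanishes in \<open>\<int>[x]/(P, p)\<close>; but there \<open>n = x P' h\<close> is invertible.\<close>

lemma root_power_prime:
  fixes P :: "int poly" and w :: complex
  assumes P: "irreducible P" "degree P > 0" and n: "n > 0" "P dvd monom 1 n - 1"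
    and p: "prime p" "\<not> p dvd n" and w: "poly (of_int_poly P) w = 0"
  shows "poly (of_int_poly P) (w ^ p) = 0"
proof (rule ccontr)
  assume neg: "poly (of_int_poly P) (w ^ p) \<noteq> 0"
  let ?X = "[:0, 1:] :: int poly"
  obtain h where h: "monom 1 n - 1 = P * h" using n(2) by (elim dvdE)
  have Ch: "monom 1 n - 1 = of_int_poly P * (of_int_poly h :: complex poly)"
    using arg_cong[OF h, of "of_int_poly :: _ \<Rightarrow> complex poly"]
    by (simp add: of_int_hom.map_poly_hom_mult)
  have eval: "x ^ n - 1 = poly (of_int_poly P) x * poly (of_int_poly h) x" for x :: complex
    using arg_cong[OF Ch, of "\<lambda>f. poly f x"] by (simp add: poly_monom)
  have "w ^ n = 1" using eval[of w] w by simp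
  then have "(w ^ p) ^ n = 1" by (metis power_mult mult.commute power_one)
  with eval[of "w ^ p"] neg have "poly (of_int_poly h) (w ^ p) = 0" by simp
  then have "poly (of_int_poly (pcompose h (monom 1 p))) w = 0"
    by (simp add: of_int_poly_pcompose_monom poly_pcompose poly_monom)
  with P w have "P dvd pcompose h (monom 1 p)" by (intro irreducible_dvd_if_common_root)
  moreover obtain q where q: "pcompose h (monom 1 p) - h ^ p = of_nat p * q"
    using frobenius_int_poly[OF p(1), of h] by (elim dvdE)
  ultimately have hp: "P dvd h ^ p + of_nat p * q" by (metis add.commute diff_add_cancel)
  let ?y = "?X * pderiv P"
  \<comment> \<open>Differentiate x^n - 1 = P h and multiply by x: since n x^n = n + n P h, this
    gives n = x P' h modulo P.\<close>
  have "pderiv (monom 1 n - 1) = pderiv P * h + P * pderiv h"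
    unfolding h by (simp add: pderiv_mult algebra_simps)
  then have "smult (int n) (monom 1 (n - 1)) = pderiv P * h + P * pderiv h"
    by (simp add: pderiv_diff pderiv_monom smult_monom)
  then have "?X * smult (int n) (monom 1 (n - 1)) = ?y * h + P * (?X * pderiv h)"
    by (simp add: algebra_simps)
  moreover have "?X * smult (int n) (monom 1 (n - 1)) = of_nat n + of_nat n * (P * h)"
    unfolding h[symmetric] using n(1)
    by (cases n) (simp_all add: of_nat_poly monom_Suc smult_diff_right algebra_simps)
  ultimately have "of_nat n - ?y * h = P * (?X * pderiv h - of_nat n * h)"
    by (simp add: algebra_simps)
  then have "P dvd of_nat n - ?y * h" by simp
  \<comment> \<open>Taking p-th powers lets h^p = -p q modulo P enter, which leaves n^p + p y^p q =
    0 modulo P with y = x P'.\<close>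
  then have "P dvd of_nat n ^ p - (?y * h) ^ p"
    by (metis dvd_mult2 power_diff_sumr2)
  moreover have "P dvd ?y ^ p * (h ^ p + of_nat p * q)" using hp by (rule dvd_mult)
  ultimately have "P dvd (of_nat n ^ p - (?y * h) ^ p) + ?y ^ p * (h ^ p + of_nat p * q)"
    by (rule dvd_add)
  also have "\<dots> = of_nat n ^ p + of_nat p * (?y ^ p * q)"
    unfolding power_mult_distrib[of ?y h] by (simp only: algebra_simps)
  also have "\<dots> = [:int n ^ p:] + smult (int p) (?y ^ p * q)"
    by (simp add: of_nat_poly poly_const_pow)
  finally obtain t where t: "P * t = [:int n ^ p:] + smult (int p) (?y ^ p * q)"
    by (metis dvdE)
  \<comment> \<open>As x^n - 1 is monic, the leading coefficient of P is a unit and survives modulo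
    p.\<close>
  have "lead_coeff P * lead_coeff h = 1"
    using lead_coeff_monom_minus_1[OF n(1)] by (simp add: h lead_coeff_mult)
  then have "\<not> int p dvd lead_coeff P"
    using p(1) not_prime_unit[of "int p"] by (metis dvd_mult2 prime_nat_int_transfer)
  with p(1) P(2) t have "int p dvd int n ^ p"
    by (intro prime_dvd_const_if_dvd_mod[of "int p" P]) auto
  with p show False by (metis int_dvd_int_iff of_nat_power prime_dvd_power)
qed

text \<open>Prime factors of \<open>k\<close> are peeled off one at a time; the induction
  generalizes \<open>w\<close> because \<open>w ^ p\<close> takes its place.\<close>

lemma root_power_coprime:
  fixes P :: "int poly" and w :: complex
  assumes P: "irreducible P" "degree P > 0" and n: "n > 0" "P dvd monom 1 n - 1"
    and "k > 0" "coprime k n" "poly (of_int_poly P) w = 0"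
  shows "poly (of_int_poly P) (w ^ k) = 0"
  using assms(5-)
proof (induction k arbitrary: w rule: less_induct)
  case (less k)
  show ?case
  proof (cases "k = 1")
    case False
    then obtain p where p: "prime p" "p dvd k" using prime_factor_nat by blast
    then obtain l where l: "k = p * l" by (elim dvdE)
    from less.prems l have "l > 0" "coprime p n" "coprime l n" by auto
    moreover have "l < k" using l \<open>l > 0\<close> prime_gt_1_nat[OF p(1)] by simp
    moreover have "\<not> p dvd n"
      using p(1) \<open>coprime p n\<close> by (metis coprime_absorb_left not_prime_unit)
    then have "poly (of_int_poly P) (w ^ p) = 0"
      using P n p(1) less.prems(3) by (intro root_power_prime)
    ultimately have "poly (of_int_poly P) ((w ^ p) ^ l) = 0" by (intro less.IH[of l "w ^ p"])
    then show ?thesis by (simp add: l power_mult)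
  qed (use less.prems in simp)
qed

text \<open>The roots of \<open>P\<close> are exactly the primitive n-th roots of unity, and they
  are simple because \<open>P\<close> divides x^n - 1.\<close>

lemma eq_cyclotomic_if_root:
  fixes P :: "int poly" and z :: complex
  assumes P: "irreducible P" "degree P > 0" and root: "poly (of_int_poly P) z = 0"
    and n: "n > 0" "z ^ n = 1" "\<And>m. 0 < m \<Longrightarrow> m < n \<Longrightarrow> z ^ m \<noteq> 1"
  shows "of_int_poly P = cyclotomic n \<or> of_int_poly P = - cyclotomic n"
proof -
  let ?P = "of_int_poly P :: complex poly"
  \<comment> \<open>All roots of P satisfy the same equations y^m = 1, hence share the order n of
    z.\<close>
  have dvd_iff: "P dvd monom 1 m - 1 \<longleftrightarrow> y ^ m = 1" if "poly ?P y = 0" for y m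
  proof
    assume "P dvd monom 1 m - 1"
    then have "?P dvd of_int_poly (monom 1 m - 1)"
      by (rule of_int_hom.map_poly_hom_dvd)
    then have "?P dvd monom 1 m - 1" by simp
    then have "poly (monom 1 m - 1) y = 0" using that by (metis dvd_trans poly_eq_0_iff_dvd)
    then show "y ^ m = 1" by (simp add: poly_monom)
  next
    assume "y ^ m = 1"
    then have "poly (of_int_poly (monom 1 m - 1)) y = 0" by (simp add: poly_monom)
    with P that show "P dvd monom 1 m - 1" by (rule irreducible_dvd_if_common_root)
  qed
  have PW: "P dvd monom 1 n - 1" using dvd_iff[OF root] n(2) by simp
  then obtain h where h: "monom 1 n - 1 = P * h" by (elim dvdE)
  have Ch: "monom 1 n - 1 = ?P * of_int_poly h"
    using arg_cong[OF h, of "of_int_poly :: _ \<Rightarrow> complex poly"]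
    by (simp add: of_int_hom.map_poly_hom_mult)

  have "bij_betw (\<lambda>k. z ^ k) {..<n} {y. y ^ n = 1}"
  proof -
    have "inj_on (\<lambda>k. z ^ k) {..<n}"
    proof (rule linorder_inj_onI)
      fix a b assume ab: "a < b" "a \<in> {..<n}" "b \<in> {..<n}"
      have "z \<noteq> 0" using n by (auto simp: power_0_left)
      have "z ^ b = z ^ a * z ^ (b - a)" using ab(1) by (simp flip: power_add)
      with n(3)[of "b - a"] ab \<open>z \<noteq> 0\<close> show "z ^ a \<noteq> z ^ b" by auto
    qed auto
    moreover from this have "(\<lambda>k. z ^ k) ` {..<n} = {y. y ^ n = 1}"
    proof (intro card_subset_eq)
      show "(\<lambda>k. z ^ k) ` {..<n} \<subseteq> {y. y ^ n = 1}"
        using n(2) by (auto simp: power_commuting_commutes simp flip: power_mult)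
          (metis power_mult mult.commute power_one)
    qed (use n(1) finite_roots_unity[of n] card_roots_unity_eq[of n] in \<open>auto simp: card_image\<close>)
    ultimately show ?thesis by (simp add: bij_betw_def)
  qed
  have roots: "{y. poly ?P y = 0} = {y. y ^ n = 1 \<and> (\<forall>m\<in>{1..<n}. y ^ m \<noteq> 1)}"
  proof (intro equalityI subsetI)
    fix y assume "y \<in> {y. poly ?P y = 0}"
    then have y: "poly ?P y = 0" by simp
    show "y \<in> {y. y ^ n = 1 \<and> (\<forall>m\<in>{1..<n}. y ^ m \<noteq> 1)}"
      using PW n(3) dvd_iff[OF y] dvd_iff[OF root] by auto
  next
    fix y :: complex assume "y \<in> {y. y ^ n = 1 \<and> (\<forall>m\<in>{1..<n}. y ^ m \<noteq> 1)}"
    then have y: "y ^ n = 1" "\<And>m. 0 < m \<Longrightarrow> m < n \<Longrightarrow> y ^ m \<noteq> 1" by auto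
    with \<open>bij_betw _ _ _\<close> obtain k where "y = z ^ k" by (auto simp: bij_betw_def)
    \<comment> \<open>Adding n makes the exponent positive, as \<open>root_power_coprime\<close>
      requires.\<close>
    then have k: "y = z ^ (k + n)" using n(2) by (simp add: power_add)
    have "coprime (k + n) n"
    proof (rule ccontr)
      \<comment> \<open>A common divisor d > 1 would give y^(n/d) = 1, against the order n of
        y.\<close>
      define d where "d = gcd (k + n) n"
      assume "\<not> coprime (k + n) n"
      then have "d > 1" using n(1) by (simp add: d_def coprime_iff_gcd_eq_1 Suc_lessI)
      obtain a b where ab: "k + n = d * a" "n = d * b"
        unfolding d_def by (meson dvdE gcd_dvd1 gcd_dvd2)
      have "(k + n) * b = n * a" unfolding ab(1) by (subst ab(2)) (simp add: ac_simps)
      then have "y ^ b = (z ^ n) ^ a" unfolding k by (metis power_mult)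
      then have "y ^ b = 1" using n(2) by simp
      moreover have "0 < b" "b < n" using ab(2) n(1) \<open>d > 1\<close> by auto
      ultimately show False using y(2) by blast
    qed
    then show "y \<in> {y. poly ?P y = 0}"
      using root_power_coprime[OF P n(1) PW, of "k + n" z] root n(1) by (simp add: k)
  qed
  have "rsquarefree ?P"
    unfolding rsquarefree_roots
  proof (intro allI notI)
    fix y assume y: "poly ?P y = 0 \<and> poly (pderiv ?P) y = 0"
    then have "y ^ n = 1" using roots by blast
    \<comment> \<open>A double root y would be a zero of n x^(n-1), contradicting y^n = 1.\<close>
    have "poly (pderiv (monom 1 n - 1)) y = 0"
      unfolding Ch using y by (simp add: pderiv_mult)
    then have "y ^ (n - 1) = 0"
      using n(1) by (simp add: pderiv_diff pderiv_monom poly_monom)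
    with \<open>y ^ n = 1\<close> n(1) show False by (metis power_eq_0_iff zero_neq_one power_0_left less_numeral_extra(3))
  qed
  then have "smult (lead_coeff ?P) (cyclotomic n) = ?P"
    using complex_poly_decompose_rsquarefree[of ?P] by (simp add: cyclotomic_def roots)
  moreover have "lead_coeff P * lead_coeff h = 1"
    using lead_coeff_monom_minus_1[OF n(1)] by (simp add: h lead_coeff_mult)
  then have "lead_coeff P = 1 \<or> lead_coeff P = - 1" by (metis zmult_eq_1_iff)
  then have "lead_coeff ?P = 1 \<or> lead_coeff ?P = - 1" by (auto simp: coeff_map_poly)
  ultimately show ?thesis by (metis smult_1_left smult_minus_left)
qed

section \<open>Conclusion\<close>

lemma poly_to_QM_const_unit:
  assumes "c \<noteq> 0"
  shows "poly_to_QM [:c:] dvd 1"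
proof -
  have "poly_to_QM [:c:] * Poly_Mapping.single 0 (1 / of_int c) = 1"
    using assms by (simp add: poly_to_QM_eq_embed map_poly_pCons root_embed_const mult_single
        del: single_of_int)
  then show ?thesis by (metis dvd_triv_left)
qed

lemma irreducible_eq_pX:
  fixes P :: "int poly"
  assumes "irreducible P" "coeff P 0 = 0"
  shows "P = pX \<or> P = - pX"
proof -
  obtain a q where "P = pCons a q" by (rule pCons_cases)
  with assms(2) have P: "P = pX * q" by simp
  moreover have "\<not> is_unit (pX :: int poly)" by (auto simp: is_unit_poly_iff)
  ultimately have "is_unit q" using irreducibleD[OF assms(1) P] by blast
  then show ?thesis unfolding P by (auto simp: is_unit_poly_iff abs_if split: if_splits)
qed

theorem theorem4p6:
  fixes P :: "int poly"
  assumes "irreducible P"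
    and "\<not> atomic (poly_to_QM P)"
  shows "P = [:0, 1:] \<or> P = - [:0, 1:] \<or>
         (\<exists>n::nat. n > 0 \<and> odd n \<and>
            (map_poly of_int P = cyclotomic n \<or> map_poly of_int P = - cyclotomic n))"
proof (cases "coeff P 0 = 0")
  case True
  with irreducible_eq_pX[OF assms(1)] show ?thesis by blast
next
  case False
  \<comment> \<open>Nonzero constants are units over Q, hence atomic.\<close>
  have deg: "degree P > 0"
  proof (rule ccontr)
    assume "\<not> degree P > 0"
    then obtain c where "P = [:c:]" by (auto elim: degree_eq_zeroE)
    with False have "poly_to_QM P dvd 1" by (simp add: poly_to_QM_const_unit)
    with assms(2) show False by (simp add: atomic_def)
  qed
  have "\<not> irreducible_product (poly_to_QM P)"
    using assms(2) by (simp add: atomic_def irreducible_product_def)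
  with assms(1) deg False obtain z :: complex and N
    where z: "poly (of_int_poly P) z = 0" and N: "z ^ N = 1" "odd N" by (rule odd_order_root)
  \<comment> \<open>N is merely some odd exponent; the order n of z divides it and is therefore
    odd.\<close>
  define n where "n = (LEAST n. n > 0 \<and> z ^ n = 1)"
  have "\<exists>n. n > 0 \<and> z ^ n = 1" using N by (intro exI[of _ N]) (auto intro: odd_pos)
  from LeastI_ex[OF this] have n: "n > 0" "z ^ n = 1" by (simp_all add: n_def)
  have minimal: "z ^ m \<noteq> 1" if "0 < m" "m < n" for m
    using that not_less_Least[of m "\<lambda>n. n > 0 \<and> z ^ n = 1"] by (auto simp: n_def)
  have "z ^ N = (z ^ n) ^ (N div n) * z ^ (N mod n)"
    by (simp flip: power_mult power_add)
  with N(1) n(2) have "z ^ (N mod n) = 1" by simp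
  with minimal[of "N mod n"] n(1) have "n dvd N" by (auto simp: mod_eq_0_iff_dvd)
  with N(2) have "odd n" using dvd_trans by blast
  with eq_cyclotomic_if_root[OF assms(1) deg z n minimal] n(1) show ?thesis by blast
qed

end
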